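(* Let $H$ be a Tonelli Hamiltonian on $\mathbb T^d$ with associated Lagrangian $L$ and critical value $\alpha(H)$. There exist $\tau_0,\eta_0,C>0$ such that $$\bigl|\bar L(h,\tau)+\alpha(H)\bigr|\le C\Big(\tau+\frac h\tau\Big)$$ for all mesh sizes $h$ and time steps $\tau$ with $0<\tau\le\tau_0$ and $h/\tau\le\eta_0$.
   Context: $\mathbb T^d=\mathbb R^d/\mathbb Z^d$. $H\in C^2(\mathbb T^d\times\mathbb R^d)$ is a Tonelli Hamiltonian: $D^2_{pp}H(x,p)>0$ everywhere and $H$ is superlinear in $p$. The Tonelli Lagrangian is $L(x,v)=\sup_{p\in\mathbb R^d}\{p\cdot v-H(x,p)\}$; it is of class $C^2$, strictly convex in $v$, and superlinear: for every $K>0$ there is $C(K)\in\mathbb R$ with $L(x,v)\ge K|v|-C(K)$ for all $(x,v)$. The critical value $\alpha(H)$ is the unique constant for which the Hamilton–Jacobi equation $H(x,Du(x))=\alpha(H)$, $x\in\mathbb T^d$, admits a viscosity solution. Mesh sizes are always of the form $h=1/N$ with $N\ge1$ an integer. The grid is $\mathcal G_h=\{x_i=ih \bmod \mathbb Z^d: i\in\{0,\dots,N-1\}^d\}$, and each grid point is identified with its representative in $[0,1)^d$. The fully-discrete Lax–Oleinik operator acts on $u_h:\mathcal G_h\to\mathbb R$ by $$(T_{h,\tau}u_h)(x_j)=\min_{x_i\in\mathcal G_h,\ \ell\in\mathbb Z^d}\Big\{u_h(x_i)+\tau L\Big(x_i,\frac{x_j+\ell-x_i}{\tau}\Big)\Big\},\qquad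 x_j\in\mathcal G_h.$$ $\bar L(h,\tau)\in\mathbb R$ is the unique constant for which the equation $T_{h,\tau}u=u+\tau\bar L(h,\tau)$ has a solution $u:\mathcal G_h\to\mathbb R$. *)

theory Defs
  imports "HOL-Analysis.Analysis"
begin

text \<open>
  The torus is \<open>\<real>\<^sup>d/\<int>\<^sup>d\<close> with \<open>d = CARD('n)\<close>; functions on it are represented by their
  \<open>\<int>\<^sup>d\<close>-periodic lifts to \<open>real^'n\<close>.
\<close>

definition int_lattice :: "(real^'n) set" where
  "int_lattice = {l. \<forall>k. l $ k \<in> \<int>}"

definition periodic :: "(real^'n \<Rightarrow> 'b) \<Rightarrow> bool" where
  "periodic f \<longleftrightarrow> (\<forall>x. \<forall>l\<in>int_lattice. f (x + l) = f x)"

definition C2_function :: "('a::real_normed_vector \<Rightarrow> real) \<Rightarrow> bool" where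
  "C2_function f \<longleftrightarrow>
    (\<exists>(f' :: 'a \<Rightarrow> 'a \<Rightarrow>\<^sub>L real) (f'' :: 'a \<Rightarrow> 'a \<Rightarrow>\<^sub>L 'a \<Rightarrow>\<^sub>L real).
      (\<forall>z. (f has_derivative blinfun_apply (f' z)) (at z)) \<and>
      (\<forall>z. (f' has_derivative blinfun_apply (f'' z)) (at z)) \<and>
      continuous_on UNIV f'')"

definition hessian :: "(real^'n \<Rightarrow> real) \<Rightarrow> real^'n \<Rightarrow> real^'n^'n" where
  "hessian f p =
    (\<chi> i j. frechet_derivative (\<lambda>q. frechet_derivative f (at q) (axis j 1)) (at p) (axis i 1))"

definition pos_definite :: "real^'n^'n \<Rightarrow> bool" where
  "pos_definite A \<longleftrightarrow> (\<forall>\<xi>. \<xi> \<noteq> 0 \<longrightarrow> \<xi> \<bullet> (A *v \<xi>) > 0)"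

text \<open>
  Superlinearity is uniform in \<open>x\<close>, as for the Lagrangian; for a continuous function, periodic in
  \<open>x\<close> and convex in \<open>p\<close>, this is the same as superlinearity at every fixed \<open>x\<close>.
\<close>

definition superlinear :: "(real^'n \<Rightarrow> real^'n \<Rightarrow> real) \<Rightarrow> bool" where
  "superlinear F \<longleftrightarrow> (\<forall>K>0. \<exists>C. \<forall>x p. F x p \<ge> K * norm p - C)"

definition tonelli_hamiltonian :: "(real^'n \<Rightarrow> real^'n \<Rightarrow> real) \<Rightarrow> bool" where
  "tonelli_hamiltonian H \<longleftrightarrow>
    periodic H \<and>
    C2_function (\<lambda>(x, p). H x p) \<and>
    (\<forall>x p. pos_definite (hessian (H x) p)) \<and>
    superlinear H"

definition lagrangian :: "(real^'n \<Rightarrow> real^'n \<Rightarrow> real) \<Rightarrow> real^'n \<Rightarrow> real^'n \<Rightarrow> real" where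
  "lagrangian H x v = (SUP p. p \<bullet> v - H x p)"

definition C1_with_gradient :: "(real^'n \<Rightarrow> real) \<Rightarrow> (real^'n \<Rightarrow> real^'n) \<Rightarrow> bool" where
  "C1_with_gradient \<phi> D\<phi> \<longleftrightarrow> (\<forall>y. GDERIV \<phi> y :> D\<phi> y) \<and> continuous_on UNIV D\<phi>"

text \<open>
  Viscosity solutions of \<open>H(x, Du(x)) = c\<close> on the torus. The conditions are local, so the test
  functions need not be periodic.
\<close>

definition viscosity_subsolution ::
    "(real^'n \<Rightarrow> real^'n \<Rightarrow> real) \<Rightarrow> real \<Rightarrow> (real^'n \<Rightarrow> real) \<Rightarrow> bool" where
  "viscosity_subsolution H c u \<longleftrightarrow>
    (\<forall>\<phi> D\<phi> x. C1_with_gradient \<phi> D\<phi> \<and> (\<forall>\<^sub>F y in nhds x. u y - \<phi> y \<le> u x - \<phi> x)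
      \<longrightarrow> H x (D\<phi> x) \<le> c)"

definition viscosity_supersolution ::
    "(real^'n \<Rightarrow> real^'n \<Rightarrow> real) \<Rightarrow> real \<Rightarrow> (real^'n \<Rightarrow> real) \<Rightarrow> bool" where
  "viscosity_supersolution H c u \<longleftrightarrow>
    (\<forall>\<phi> D\<phi> x. C1_with_gradient \<phi> D\<phi> \<and> (\<forall>\<^sub>F y in nhds x. u y - \<phi> y \<ge> u x - \<phi> x)
      \<longrightarrow> H x (D\<phi> x) \<ge> c)"

definition viscosity_solution ::
    "(real^'n \<Rightarrow> real^'n \<Rightarrow> real) \<Rightarrow> real \<Rightarrow> (real^'n \<Rightarrow> real) \<Rightarrow> bool" where
  "viscosity_solution H c u \<longleftrightarrow>
    continuous_on UNIV u \<and> periodic u \<and>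
    viscosity_subsolution H c u \<and> viscosity_supersolution H c u"

definition critical_value :: "(real^'n \<Rightarrow> real^'n \<Rightarrow> real) \<Rightarrow> real" where
  "critical_value H = (THE c. \<exists>u. viscosity_solution H c u)"

text \<open>The grid of mesh size \<open>1/N\<close>, through its representatives in \<open>[0,1)\<^sup>d\<close>.\<close>

definition grid :: "nat \<Rightarrow> (real^'n) set" where
  "grid N = {\<chi> k. real (i k) / real N | i :: 'n \<Rightarrow> nat. \<forall>k. i k < N}"

text \<open>
  The infimum is over an infinite set, but for a superlinear \<open>L\<close>, \<open>N \<ge> 1\<close> and \<open>\<tau> > 0\<close> it is attained,
  so it is the minimum. Only the values of \<open>u\<close> on the grid enter.
\<close>

definition lax_oleinik ::
    "(real^'n \<Rightarrow> real^'n \<Rightarrow> real) \<Rightarrow> nat \<Rightarrow> real \<Rightarrow> (real^'n \<Rightarrow> real) \<Rightarrow> real^'n \<Rightarrow> real" where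
  "lax_oleinik L N \<tau> u y =
    (INF (x, l) \<in> grid N \<times> int_lattice. u x + \<tau> * L x ((y + l - x) /\<^sub>R \<tau>))"

definition discrete_critical_value ::
    "(real^'n \<Rightarrow> real^'n \<Rightarrow> real) \<Rightarrow> nat \<Rightarrow> real \<Rightarrow> real" where
  "discrete_critical_value L N \<tau> =
    (THE c. \<exists>u. \<forall>y\<in>grid N. lax_oleinik L N \<tau> u y = u y + \<tau> * c)"

end

theory Submission
  imports Defs
begin

text \<open>
  The proof uses no calculus of variations: the weak KAM solution is obtained from the scheme itself.
  Solutions of the discrete equation are Lipschitz up to \<open>O(\<tau>)\<close> and their optimal steps have velocity
  \<open>O(1)\<close>, uniformly in \<open>\<tau>\<close> and \<open>h \<le> \<tau>\<close>. Running along lattice points close to a segment, and applying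
  Jensen's inequality to an optimal chain of \<open>n\<close> steps, one compares \<open>n\<close> fine steps with a single step of
  length \<open>t = n \<tau>\<close>, up to an error \<open>O(t\<^sup>2 + t h/\<tau>)\<close>. For \<open>\<tau> \<rightarrow> 0\<close> and \<open>h/\<tau> \<rightarrow> 0\<close> the lower limit \<open>u\<close> of fine
  solutions therefore satisfies the one-step equation with constant \<open>c\<close> up to \<open>O(t\<^sup>2)\<close>, for every \<open>t > 0\<close>.
  Dividing by \<open>t\<close> shows that \<open>u\<close> is a viscosity solution for the value \<open>-c\<close>, which is the critical value
  by comparison. Taking \<open>t = \<tau>\<close> and rounding to the mesh, \<open>u\<close> is a sub- and a supersolution
  of the discrete equation up to \<open>O(\<tau> + h/\<tau>)\<close>, and this bounds the discrete value.
\<close>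

subsection \<open>Lower limits of bounded real sequences\<close>

text \<open>Solutions for different meshes live on different lattices and are Lipschitz only up to a
  defect of one time step. A lower limit of rounded samples copes with both: an upper bound for it
  may be read off along any subsequence, and at a single point some subsequence realizes it. With
  these two facts an inequality between all pairs of points, and the existence of a good
  predecessor, both survive the limit, although the functions themselves need not converge. The
  quotient \<open>h/\<tau>\<close> is the change of velocity caused by moving the ends of a step to
  mesh points. Requiring \<open>h \<le> \<tau>\<close> keeps the velocities in a fixed ball, on
  which \<open>L\<close> is Lipschitz. The constant \<open>c\<close> arises as a limit of discrete
  values along one sequence of meshes, without a rate. The rate comes from comparing every discrete
  solution with one fixed Lipschitz function.\<close>

definition real_liminf :: "(nat \<Rightarrow> real) \<Rightarrow> real" where
  "real_liminf f = real_of_ereal (liminf (\<lambda>n. ereal (f n)))"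

text \<open>\<open>real_of_ereal\<close> sends infinite values to 0, so the conversion is faithful
  only for a finite lower limit; boundedness guarantees this.\<close>

lemma ereal_real_liminf:
  assumes "Bseq f"
  shows "ereal (real_liminf f) = liminf (\<lambda>n. ereal (f n))"
proof -
  obtain B where B: "\<And>n. \<bar>f n\<bar> \<le> B"
    using assms by (auto simp: Bseq_def)
  have "ereal (- B) \<le> liminf (\<lambda>n. ereal (f n))"
    using B by (intro Liminf_bounded) (auto simp: abs_le_iff minus_le_iff)
  moreover have "liminf (\<lambda>n. ereal (f n)) \<le> ereal B"
  proof -
    have "liminf (\<lambda>n. ereal (f n)) \<le> limsup (\<lambda>n. ereal (f n))"
      by (rule Liminf_le_Limsup) simp
    also have "\<dots> \<le> ereal B"
      using B by (intro Limsup_bounded) (auto simp: abs_le_iff)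
    finally show ?thesis .
  qed
  ultimately show ?thesis
    unfolding real_liminf_def by (cases "liminf (\<lambda>n. ereal (f n))") auto
qed

lemma real_liminf_subseq:
  assumes "Bseq f"
  obtains r where "strict_mono r" "(\<lambda>k. f (r k)) \<longlonglongrightarrow> real_liminf f"
proof -
  obtain r where "strict_mono r" "((\<lambda>n. ereal (f n)) \<circ> r) \<longlonglongrightarrow> liminf (\<lambda>n. ereal (f n))"
    using liminf_subseq_lim by blast
  then show ?thesis
    using that[of r] by (simp add: o_def flip: ereal_real_liminf[OF assms])
qed

text \<open>Upper bounds need only a subsequence. This later permits passing to one along which
  optimal predecessors converge.\<close>

lemma real_liminf_le_subseq:
  assumes "Bseq f" "strict_mono r" "\<forall>\<^sub>F k in sequentially. f (r k) \<le> g k" "g \<longlonglongrightarrow> A"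
  shows "real_liminf f \<le> A"
proof -
  have "liminf (\<lambda>n. ereal (f n)) \<le> liminf ((\<lambda>n. ereal (f n)) \<circ> r)"
    by (rule liminf_subseq_mono) fact
  also have "\<dots> \<le> liminf (\<lambda>k. ereal (g k))"
    using assms(3) by (intro Liminf_mono) (auto elim: eventually_mono)
  also have "\<dots> = ereal A"
    using assms(4) by (intro lim_imp_Liminf) auto
  finally show ?thesis
    by (simp flip: ereal_real_liminf[OF assms(1)])
qed

lemma real_liminf_mono:
  assumes "Bseq f" "Bseq g" "\<forall>\<^sub>F k in sequentially. f k \<le> g k + a k" "a \<longlonglongrightarrow> A"
  shows "real_liminf f \<le> real_liminf g + A"
proof -
  obtain r where r: "strict_mono r" "(\<lambda>k. g (r k)) \<longlonglongrightarrow> real_liminf g"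
    using real_liminf_subseq[OF assms(2)] .
  have "(\<lambda>k. g (r k) + a (r k)) \<longlonglongrightarrow> real_liminf g + A"
    using r LIMSEQ_subseq_LIMSEQ[OF assms(4) r(1)] by (intro tendsto_add) (auto simp: o_def)
  then show ?thesis
    by (rule real_liminf_le_subseq[OF assms(1) r(1) eventually_subseq[OF r(1) assms(3)]])
qed

lemma real_liminf_ge:
  assumes "Bseq f" "\<forall>\<^sub>F k in sequentially. a \<le> f k"
  shows "a \<le> real_liminf f"
proof -
  have "ereal a \<le> liminf (\<lambda>n. ereal (f n))"
    using assms(2) by (intro Liminf_bounded) (auto elim: eventually_mono)
  then show ?thesis
    by (simp flip: ereal_real_liminf[OF assms(1)])
qed

lemma real_liminf_less_eventually:
  assumes "Bseq f" "a < real_liminf f"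
  shows "\<forall>\<^sub>F k in sequentially. a < f k"
proof -
  have "ereal a < liminf (\<lambda>n. ereal (f n))"
    using assms(2) by (simp flip: ereal_real_liminf[OF assms(1)])
  from less_LiminfD[OF this] show ?thesis
    by simp
qed

lemma real_liminf_Suc_le:
  assumes "Bseq f" shows "real_liminf f \<le> real_liminf (\<lambda>k. f (Suc k))"
proof -
  have B: "Bseq (\<lambda>k. f (Suc k))"
    using assms Bseq_Suc_iff by blast
  obtain r where r: "strict_mono r" "(\<lambda>k. f (Suc (r k))) \<longlonglongrightarrow> real_liminf (\<lambda>k. f (Suc k))"
    using real_liminf_subseq[OF B] .
  show ?thesis
    by (rule real_liminf_le_subseq[OF assms _ _ r(2), where r = "\<lambda>k. Suc (r k)"])
      (use r(1) in \<open>auto simp: strict_mono_def\<close>)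
qed

subsection \<open>The finite min-plus eigenvalue problem\<close>

text \<open>Two-sided form of Fekete's lemma: \<open>a + D\<close> is subadditive and
  \<open>a - D\<close> superadditive, so comparison at \<open>n * k\<close> puts every
  \<open>(a n - D) / n\<close> below every \<open>(a k + D) / k\<close>. Any number in between
  serves as the slope.\<close>

lemma quasi_additive_linear_growth:
  fixes a :: "nat \<Rightarrow> real"
  assumes "\<And>n k. \<bar>a (n + k) - a n - a k\<bar> \<le> D"
  obtains c where "\<And>n. \<bar>a n - real n * c\<bar> \<le> D"
proof -
  have D: "D \<ge> 0"
    using assms[of 0 0] by linarith
  have mult: "a (n * k) + D \<le> real n * (a k + D)" "real n * (a k - D) \<le> a (n * k) - D" if "n \<ge> 1" for n k
    using that
  proof (induction n rule: dec_induct)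
    case base
    { case 1 show ?case by simp }
    { case 2 show ?case by simp }
  next
    case (step n)
    have *: "a (Suc n * k) - a (n * k) - a k \<le> D" "- D \<le> a (Suc n * k) - a (n * k) - a k"
      using assms[of "n * k" k] by (auto simp: abs_le_iff add.commute)
    { case 1 show ?case using step.IH(1) * by (simp add: algebra_simps) }
    { case 2 show ?case using step.IH(2) * by (simp add: algebra_simps) }
  qed
  have le: "(a n - D) / n \<le> (a k + D) / k" if "n \<ge> 1" "k \<ge> 1" for n k
  proof -
    have "real k * (a n - D) \<le> real n * (a k + D)"
      using mult(1)[OF that(1), of k] mult(2)[OF that(2), of n] D by (simp add: mult.commute)
    then show ?thesis
      using that by (simp add: field_simps)
  qed
  define c where "c = (INF k\<in>{1..}. (a k + D) / real k)"
  have bdd: "bdd_below ((\<lambda>k. (a k + D) / real k) ` {1..})"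
    using le[of 1] by (intro bdd_belowI[of _ "(a 1 - D) / real 1"]) auto
  have up: "c \<le> (a k + D) / k" if "k \<ge> 1" for k
    unfolding c_def using that by (intro cINF_lower[OF bdd]) auto
  have low: "(a n - D) / n \<le> c" if "n \<ge> 1" for n
    unfolding c_def using that le by (intro cINF_greatest) auto
  have "\<bar>a n - real n * c\<bar> \<le> D" for n
  proof (cases "n = 0")
    case True
    then show ?thesis using assms[of 0 0] by simp
  next
    case False
    then show ?thesis using up[of n] low[of n] by (simp add: field_simps abs_le_iff)
  qed
  then show ?thesis using that by blast
qed

text \<open>The eigenvalue is the linear growth rate of the iterates of \<open>T\<close> started at
  0. Their oscillation is bounded uniformly in time; hence their value at one point is
  quasi-additive, and the renormalized iterates stay bounded.\<close>

lemma min_plus_eigenvector: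
  fixes W :: "'a \<Rightarrow> 'a \<Rightarrow> real"
  assumes "finite G" "G \<noteq> {}"
  obtains c u where "\<And>y z. y \<in> G \<Longrightarrow> z \<in> G \<Longrightarrow> u y + c \<le> u z + W z y"
    "\<And>y. y \<in> G \<Longrightarrow> \<exists>z\<in>G. u z + W z y \<le> u y + c"
proof -
  define T where "T u y = Min ((\<lambda>z. u z + W z y) ` G)" for u y
  have T_le: "T u y \<le> u z + W z y" if "z \<in> G" for u y z
    unfolding T_def using assms that by (intro Min_le) auto
  have T_attained: "\<exists>z\<in>G. T u y = u z + W z y" for u y
  proof -
    have "T u y \<in> (\<lambda>z. u z + W z y) ` G"
      unfolding T_def using assms by (intro Min_in) auto
    then show ?thesis by auto
  qed
  obtain g where g: "g \<in> G"
    using assms by auto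
  define v where "v n = (T ^^ n) (\<lambda>_. 0)" for n
  have v_0: "v 0 y = 0" and v_Suc: "v (Suc n) = T (v n)" for n y
    by (auto simp: v_def)
  define B where "B = Max ((\<lambda>(z, y). \<bar>W z y\<bar>) ` (G \<times> G))"
  have B: "\<bar>W z y\<bar> \<le> B" if "z \<in> G" "y \<in> G" for z y
    unfolding B_def using assms that by (intro Max_ge) (auto intro!: image_eqI[of _ _ "(z, y)"])
  have B0: "B \<ge> 0"
    using B[OF g g] by linarith
  \<comment> \<open>The bound does not grow with \<open>n\<close>: both values can use the same last
    predecessor \<open>z\<close>, and then they differ by two entries of \<open>W\<close>.\<close>
  have osc: "v n y \<le> v n y' + 2 * B" if "y \<in> G" "y' \<in> G" for n y y'
  proof (cases n)
    case 0
    then show ?thesis using B0 by (simp add: v_0)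
  next
    case (Suc m)
    obtain z where "z \<in> G" "T (v m) y' = v m z + W z y'"
      using T_attained by blast
    then show ?thesis
      using T_le[of z "v m" y] B[of z y] B[of z y'] that by (simp add: Suc v_Suc abs_le_iff)
  qed
  have upper: "v (n + k) y \<le> v k y + (v n g + 2 * B)" if "y \<in> G" for n k y
    using that
  proof (induction k arbitrary: y)
    case 0
    then show ?case using osc[of y g n] g by (simp add: v_0)
  next
    case (Suc k)
    obtain z where "z \<in> G" "T (v k) y = v k z + W z y"
      using T_attained by blast
    then show ?case
      using T_le[of z "v (n + k)" y] Suc.IH[of z] by (simp add: v_Suc)
  qed
  have lower: "v k y + (v n g - 2 * B) \<le> v (n + k) y" if "y \<in> G" for n k y
    using that
  proof (induction k arbitrary: y)
    case 0
    then show ?case using osc[of g y n] g by (simp add: v_0)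
  next
    case (Suc k)
    obtain z where "z \<in> G" "T (v (n + k)) y = v (n + k) z + W z y"
      using T_attained by blast
    then show ?case
      using T_le[of z "v k" y] Suc.IH[of z] by (simp add: v_Suc)
  qed
  have "\<bar>v (n + k) g - v n g - v k g\<bar> \<le> 2 * B" for n k
    using upper[OF g, of n k] lower[OF g, of k n] by (simp add: abs_le_iff)
  then obtain c where c: "\<And>n. \<bar>v n g - real n * c\<bar> \<le> 2 * B"
    using quasi_additive_linear_growth[of "\<lambda>n. v n g" "2 * B"] by blast
  define f where "f y n = v n y - real n * c" for y n
  have Bseq: "Bseq (f y)" if "y \<in> G" for y
  proof (rule BseqI')
    fix n show "norm (f y n) \<le> 4 * B"
      using c[of n] osc[of y g n] osc[of g y n] that g by (auto simp: f_def abs_le_iff)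
  qed
  \<comment> \<open>The renormalized iterates may oscillate forever, so the eigenvector is their
    lower limit.\<close>
  define u where "u y = real_liminf (f y)" for y
  have "u y + c \<le> u z + W z y" if "y \<in> G" "z \<in> G" for y z
  proof -
    have "real_liminf (\<lambda>k. f y (Suc k)) \<le> real_liminf (f z) + (W z y - c)"
    proof (rule real_liminf_mono)
      show "\<forall>\<^sub>F k in sequentially. f y (Suc k) \<le> f z k + (W z y - c)"
        using T_le[OF that(2), of "v _" y] by (auto simp: f_def v_Suc algebra_simps)
    qed (use Bseq[OF that(1)] Bseq[OF that(2)] Bseq_Suc_iff in \<open>auto\<close>)
    then show ?thesis
      using real_liminf_Suc_le[OF Bseq[OF that(1)]] by (simp add: u_def)
  qed
  moreover have "\<exists>z\<in>G. u z + W z y \<le> u y + c" if "y \<in> G" for y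
  proof (rule ccontr)
    assume "\<not> ?thesis"
    then have gap: "u z + W z y > u y + c" if "z \<in> G" for z
      using that by auto
    \<comment> \<open>As \<open>G\<close> is finite, a strict gap at each predecessor is a uniform
      gap, and it is visible in all iterates from one time on. Every later value at \<open>y\<close>
      then exceeds the lower limit at \<open>y\<close> by a fixed amount.\<close>
    define m where "m = Min ((\<lambda>z. u z + W z y) ` G)"
    have m: "m \<le> u z + W z y" if "z \<in> G" for z
      unfolding m_def using assms that by (intro Min_le) auto
    have "m > u y + c"
      unfolding m_def using assms gap by (subst Min_gr_iff) auto
    then obtain e where e: "u y + c < e" "e < m"
      using dense by blast
    have "\<forall>\<^sub>F k in sequentially. \<forall>z\<in>G. e - W z y < f z k"
    proof (rule eventually_ball_finite[OF assms(1)], rule ballI)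
      fix z assume "z \<in> G"
      then show "\<forall>\<^sub>F k in sequentially. e - W z y < f z k"
        using m[of z] e by (intro real_liminf_less_eventually Bseq) (auto simp flip: u_def)
    qed
    then have "\<forall>\<^sub>F k in sequentially. e - c \<le> f y (Suc k)"
    proof (rule eventually_mono)
      fix k assume *: "\<forall>z\<in>G. e - W z y < f z k"
      obtain z where "z \<in> G" "T (v k) y = v k z + W z y"
        using T_attained by blast
      then show "e - c \<le> f y (Suc k)"
        using * by (force simp: f_def v_Suc algebra_simps)
    qed
    then have "\<forall>\<^sub>F k in sequentially. e - c \<le> f y k"
      by (subst (asm) eventually_sequentially_Suc)
    then have "e - c \<le> u y"
      unfolding u_def by (intro real_liminf_ge Bseq that)
    then show False using e by simp
  qed
  ultimately show ?thesis using that by blast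
qed

subsection \<open>Lattices\<close>

definition mesh_lattice :: "nat \<Rightarrow> (real^'n) set" where
  "mesh_lattice N = {x. \<forall>k. real N * x $ k \<in> \<int>}"

definition mesh_floor :: "nat \<Rightarrow> real^'n \<Rightarrow> real^'n" where
  "mesh_floor N x = (\<chi> k. of_int \<lfloor>real N * x $ k\<rfloor> / real N)"

definition frac_vec :: "real^'n \<Rightarrow> real^'n" where
  "frac_vec x = (\<chi> k. frac (x $ k))"

lemma int_lattice_diff: "l \<in> int_lattice \<Longrightarrow> m \<in> int_lattice \<Longrightarrow> l - m \<in> int_lattice"
  and int_lattice_minus: "l \<in> int_lattice \<Longrightarrow> - l \<in> int_lattice"
  and int_lattice_0: "0 \<in> int_lattice"
  by (auto simp: int_lattice_def)

lemma periodicD: "periodic f \<Longrightarrow> l \<in> int_lattice \<Longrightarrow> f (x + l) = f x"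
  by (auto simp: periodic_def)

lemma periodicD_minus: "periodic f \<Longrightarrow> l \<in> int_lattice \<Longrightarrow> f (x - l) = f x"
  using periodicD[of f "- l" x] int_lattice_minus[of l] by simp

lemma frac_vec_diff: "x - frac_vec x \<in> int_lattice"
  by (simp add: int_lattice_def frac_vec_def frac_def)

lemma periodic_frac_vec: "periodic f \<Longrightarrow> f (frac_vec x) = f x"
  using periodicD_minus[of f "x - frac_vec x" x] frac_vec_diff[of x] by simp

lemma frac_vec_add: "l \<in> int_lattice \<Longrightarrow> frac_vec (x + l) = frac_vec x"
  by (auto simp: int_lattice_def frac_vec_def vec_eq_iff frac_def elim!: Ints_cases dest!: spec)

lemma periodic_comp_frac_vec: "periodic (u \<circ> frac_vec)"
  by (simp add: periodic_def frac_vec_add)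

lemma frac_vec_in_cbox: "frac_vec x \<in> cbox 0 1"
  by (auto simp: mem_box_cart frac_vec_def frac_ge_0 frac_lt_1 less_imp_le)

lemma frac_vec_in_grid:
  assumes "N \<ge> 1" "x \<in> mesh_lattice N"
  shows "frac_vec x \<in> grid N"
proof -
  define i where "i k = nat \<lfloor>real N * frac (x $ k)\<rfloor>" for k
  have "real N * frac (x $ k) \<in> \<int>" for k
    using assms by (auto simp: mesh_lattice_def frac_def right_diff_distrib)
  then have eq: "real N * frac (x $ k) = of_int \<lfloor>real N * frac (x $ k)\<rfloor>" for k
    by (metis Ints_cases floor_of_int)
  have "0 \<le> real N * frac (x $ k)" "real N * frac (x $ k) < real N" for k
    using assms by (auto simp: frac_ge_0 frac_lt_1)
  then have "real (i k) = real N * frac (x $ k)" "i k < N" for k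
    unfolding i_def using eq[of k] by (auto simp: nat_less_iff floor_less_iff)
  then have "frac_vec x = (\<chi> k. real (i k) / real N)" "\<forall>k. i k < N"
    using assms by (auto simp: frac_vec_def vec_eq_iff)
  then show ?thesis
    unfolding grid_def by blast
qed

lemma frac_vec_grid: "x \<in> grid N \<Longrightarrow> frac_vec x = x"
  by (auto simp: grid_def frac_vec_def vec_eq_iff frac_eq divide_less_eq)

lemma grid_subset_mesh_lattice: "grid N \<subseteq> mesh_lattice N"
  by (auto simp: grid_def mesh_lattice_def)

lemma finite_grid: "finite (grid N :: (real^'n) set)"
proof -
  have "(grid N :: (real^'n) set) \<subseteq> (\<lambda>i. \<chi> k. real (i k) / real N) ` (UNIV \<rightarrow>\<^sub>E {..<N})"
    by (auto simp: grid_def PiE_def)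
  then show ?thesis
    by (rule finite_subset) (intro finite_imageI finite_PiE, auto)
qed

lemma zero_in_grid: "N \<ge> 1 \<Longrightarrow> 0 \<in> grid N"
  unfolding grid_def by (rule CollectI, rule exI[of _ "\<lambda>_. 0"]) (auto simp: vec_eq_iff)

lemma mesh_lattice_add_int: "x \<in> mesh_lattice N \<Longrightarrow> l \<in> int_lattice \<Longrightarrow> x + l \<in> mesh_lattice N"
  by (auto simp: mesh_lattice_def int_lattice_def distrib_left)

lemma mesh_floor_in: "N \<ge> 1 \<Longrightarrow> mesh_floor N x \<in> mesh_lattice N"
  by (auto simp: mesh_lattice_def mesh_floor_def)

lemma mesh_floor_id: "N \<ge> 1 \<Longrightarrow> x \<in> mesh_lattice N \<Longrightarrow> mesh_floor N x = x"
  by (auto simp: mesh_lattice_def mesh_floor_def vec_eq_iff field_simps of_int_floor)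

lemma mesh_floor_add_int:
  assumes "N \<ge> 1" "l \<in> int_lattice"
  shows "mesh_floor N (x + l) = mesh_floor N x + l"
proof -
  have "of_int \<lfloor>real N * (x $ k + l $ k)\<rfloor> / real N = of_int \<lfloor>real N * x $ k\<rfloor> / real N + l $ k" for k
  proof -
    obtain m where m: "l $ k = of_int m"
      using assms(2) by (auto simp: int_lattice_def elim!: Ints_cases dest: spec[of _ k])
    have "real N * (x $ k + l $ k) = real N * x $ k + of_int (int N * m)"
      by (simp add: m algebra_simps)
    then have "\<lfloor>real N * (x $ k + l $ k)\<rfloor> = \<lfloor>real N * x $ k\<rfloor> + int N * m"
      by (metis floor_add_int)
    then show ?thesis
      using assms(1) by (simp add: m add_divide_distrib)
  qed
  then show ?thesis
    by (simp add: mesh_floor_def vec_eq_iff)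
qed

text \<open>Each coordinate moves by at most \<open>1 / N\<close>; the factor
  \<open>CARD('n)\<close> comes from bounding the Euclidean norm by the l1 norm.\<close>

lemma norm_mesh_floor_diff:
  fixes x :: "real^'n"
  assumes "N \<ge> 1"
  shows "norm (mesh_floor N x - x) \<le> real CARD('n) / real N"
proof -
  have "\<bar>(mesh_floor N x - x) $ k\<bar> \<le> 1 / real N" for k
  proof -
    have "(mesh_floor N x - x) $ k = (of_int \<lfloor>real N * x $ k\<rfloor> - real N * x $ k) / real N"
      using assms by (simp add: mesh_floor_def diff_divide_distrib)
    moreover have "\<bar>of_int \<lfloor>real N * x $ k\<rfloor> - real N * x $ k\<bar> \<le> 1"
      by linarith
    ultimately show ?thesis
      by (simp add: divide_right_mono)
  qed
  then have "(\<Sum>k\<in>UNIV. \<bar>(mesh_floor N x - x) $ k\<bar>) \<le> (\<Sum>k\<in>(UNIV::'n set). 1 / real N)"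
    by (intro sum_mono)
  then show ?thesis
    using norm_le_l1_cart[of "mesh_floor N x - x"] by simp
qed

lemma finite_int_lattice_ball: "finite {l \<in> int_lattice :: (real^'n) set. norm l \<le> R}"
proof -
  have "{l \<in> int_lattice :: (real^'n) set. norm l \<le> R}
    \<subseteq> (\<lambda>i. \<chi> k. real_of_int (i k)) ` (UNIV \<rightarrow>\<^sub>E {-\<lceil>R\<rceil>..\<lceil>R\<rceil>})"
  proof
    fix l :: "real^'n" assume l: "l \<in> {l \<in> int_lattice. norm l \<le> R}"
    define i where "i k = \<lfloor>l $ k\<rfloor>" for k
    have i: "l $ k = of_int (i k)" for k
      using l by (auto simp: i_def int_lattice_def of_int_floor)
    have "\<bar>i k\<bar> \<le> \<lceil>R\<rceil>" for k
    proof -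
      have "\<bar>of_int (i k)\<bar> \<le> R"
        using component_le_norm_cart[of l k] l by (simp add: i)
      then show ?thesis by linarith
    qed
    then have "i \<in> UNIV \<rightarrow>\<^sub>E {-\<lceil>R\<rceil>..\<lceil>R\<rceil>}"
      by (auto simp: abs_le_iff minus_le_iff)
    moreover have "l = (\<chi> k. of_int (i k))"
      using i by (simp add: vec_eq_iff)
    ultimately show "l \<in> (\<lambda>i. \<chi> k. real_of_int (i k)) ` (UNIV \<rightarrow>\<^sub>E {-\<lceil>R\<rceil>..\<lceil>R\<rceil>})"
      by blast
  qed
  then show ?thesis
    by (rule finite_subset) (intro finite_imageI finite_PiE, auto)
qed

text \<open>Stands in for compactness: the integer shifts are infinitely many, but coercivity leaves
  finitely many below any level.\<close>

lemma minimum_attained_of_finite_sublevels: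
  fixes f :: "'a \<Rightarrow> real"
  assumes "S \<noteq> {}" "\<And>M. finite {s \<in> S. f s \<le> M}"
  obtains s where "s \<in> S" "\<And>t. t \<in> S \<Longrightarrow> f s \<le> f t"
proof -
  obtain s0 where s0: "s0 \<in> S"
    using assms(1) by blast
  obtain s where s: "s \<in> S" "f s \<le> f s0" "\<And>t. t \<in> S \<Longrightarrow> f t \<le> f s0 \<Longrightarrow> f s \<le> f t"
    using ex_min_if_finite[of "f ` {s \<in> S. f s \<le> f s0}"] assms(2)[of "f s0"] s0
    by (fastforce simp: not_less)
  have "f s \<le> f t" if "t \<in> S" for t
    using s(2) s(3)[OF that] by linarith
  then show ?thesis
    using that s(1) by blast
qed

subsection \<open>Discrete solutions on the periodic lattice\<close>

text \<open>
  On lifts the pair of a grid point and an integer shift becomes one point of the lattice, and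
  \<open>T u = u + \<tau> c\<close> splits into an inequality for all predecessors and its attainment.
\<close>

definition discrete_solution ::
    "(real^'n \<Rightarrow> real^'n \<Rightarrow> real) \<Rightarrow> nat \<Rightarrow> real \<Rightarrow> real \<Rightarrow> (real^'n \<Rightarrow> real) \<Rightarrow> bool" where
  "discrete_solution L N \<tau> c u \<longleftrightarrow> periodic u \<and>
    (\<forall>y\<in>mesh_lattice N. \<forall>z\<in>mesh_lattice N. u y + \<tau> * c \<le> u z + \<tau> * L z ((y - z) /\<^sub>R \<tau>)) \<and>
    (\<forall>y\<in>mesh_lattice N. \<exists>z\<in>mesh_lattice N. u z + \<tau> * L z ((y - z) /\<^sub>R \<tau>) \<le> u y + \<tau> * c)"

lemma periodic_attains_min_on_mesh:
  fixes f :: "real^'n \<Rightarrow> real"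
  assumes "N \<ge> 1" "periodic f"
  obtains y where "y \<in> mesh_lattice N" "\<And>z. z \<in> mesh_lattice N \<Longrightarrow> f y \<le> f z"
proof -
  obtain y where y: "y \<in> grid N" "\<And>z. z \<in> grid N \<Longrightarrow> f y \<le> f z"
  proof (rule minimum_attained_of_finite_sublevels[of "grid N :: (real^'n) set" f])
    show "(grid N :: (real^'n) set) \<noteq> {}"
      using zero_in_grid[OF assms(1)] by blast
    show "finite {y \<in> grid N. f y \<le> M}" for M
      by (simp add: finite_grid)
  qed blast
  have "f y \<le> f z" if "z \<in> mesh_lattice N" for z
    using y(2)[OF frac_vec_in_grid[OF assms(1) that]] periodic_frac_vec[OF assms(2), of z] by simp
  then show ?thesis
    using that y(1) grid_subset_mesh_lattice by blast
qed

text \<open>Discrete maximum principle: at the minimum \<open>y\<close> of \<open>u - w\<close>,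
  follow the predecessor optimal for \<open>u\<close>. The same step is admissible for
  \<open>w\<close>, the costs cancel, and minimality disposes of the remaining difference.\<close>

lemma subsolution_le_discrete_value:
  fixes w :: "real^'n \<Rightarrow> real"
  assumes "N \<ge> 1" "\<tau> > 0" "discrete_solution L N \<tau> c u" "periodic w"
    and "\<And>y z. y \<in> mesh_lattice N \<Longrightarrow> z \<in> mesh_lattice N \<Longrightarrow>
      w y + \<tau> * a \<le> w z + \<tau> * L z ((y - z) /\<^sub>R \<tau>)"
  shows "a \<le> c"
proof -
  have "periodic (\<lambda>x. u x - w x)"
    using assms(3,4) by (auto simp: discrete_solution_def periodic_def)
  then obtain y where y: "y \<in> mesh_lattice N" "\<And>z. z \<in> mesh_lattice N \<Longrightarrow> u y - w y \<le> u z - w z"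
    using periodic_attains_min_on_mesh[OF assms(1), of "\<lambda>x. u x - w x"] by blast
  obtain z where z: "z \<in> mesh_lattice N" "u z + \<tau> * L z ((y - z) /\<^sub>R \<tau>) \<le> u y + \<tau> * c"
    using assms(3) y(1) by (auto simp: discrete_solution_def)
  have "\<tau> * a \<le> \<tau> * c"
    using z(2) y(2)[OF z(1)] assms(5)[OF y(1) z(1)] by linarith
  then show ?thesis
    using assms(2) by simp
qed

text \<open>The roles are exchanged: at the minimum of \<open>w - u\<close> the step is good for
  \<open>w\<close> and merely admissible for \<open>u\<close>.\<close>

lemma discrete_value_le_supersolution:
  fixes w :: "real^'n \<Rightarrow> real"
  assumes "N \<ge> 1" "\<tau> > 0" "discrete_solution L N \<tau> c u" "periodic w"
    and "\<And>y. y \<in> mesh_lattice N \<Longrightarrow>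
      \<exists>z\<in>mesh_lattice N. w z + \<tau> * L z ((y - z) /\<^sub>R \<tau>) \<le> w y + \<tau> * b"
  shows "c \<le> b"
proof -
  have "periodic (\<lambda>x. w x - u x)"
    using assms(3,4) by (auto simp: discrete_solution_def periodic_def)
  then obtain y where y: "y \<in> mesh_lattice N" "\<And>z. z \<in> mesh_lattice N \<Longrightarrow> w y - u y \<le> w z - u z"
    using periodic_attains_min_on_mesh[OF assms(1), of "\<lambda>x. w x - u x"] by blast
  obtain z where z: "z \<in> mesh_lattice N" "w z + \<tau> * L z ((y - z) /\<^sub>R \<tau>) \<le> w y + \<tau> * b"
    using assms(5) y(1) by blast
  have "u y + \<tau> * c \<le> u z + \<tau> * L z ((y - z) /\<^sub>R \<tau>)"
    using assms(3) y(1) z(1) by (auto simp: discrete_solution_def)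
  then have "\<tau> * c \<le> \<tau> * b"
    using z(2) y(2)[OF z(1)] by linarith
  then show ?thesis
    using assms(2) by simp
qed

lemma discrete_solution_value_unique:
  assumes "N \<ge> 1" "\<tau> > 0" "discrete_solution L N \<tau> c u" "discrete_solution L N \<tau> c' u'"
  shows "c = c'"
proof (rule antisym)
  show "c \<le> c'"
    using assms by (intro discrete_value_le_supersolution[OF assms(1-3), of u'])
      (auto simp: discrete_solution_def)
  show "c' \<le> c"
    using assms by (intro subsolution_le_discrete_value[OF assms(1-3), of u'])
      (auto simp: discrete_solution_def)
qed

text \<open>The interface between the scheme and the Legendre transform. A Lipschitz bound in both
  variables, uniform in position and local in velocity, takes the place of derivatives of
  \<open>L\<close>.\<close>

locale tonelli_lagrangian =
  fixes L :: "real^'n \<Rightarrow> real^'n \<Rightarrow> real"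
  assumes L_periodic: "periodic L"
    and L_convex: "convex_on UNIV (L x)"
    and L_superlinear: "\<exists>C. \<forall>x v. K * norm v - C \<le> L x v"
    and L_bounded: "\<exists>C. \<forall>x v. norm v \<le> R \<longrightarrow> L x v \<le> C"
    and L_lipschitz: "\<exists>C\<ge>0. \<forall>x y v w. norm v \<le> R \<longrightarrow> norm w \<le> R \<longrightarrow>
      \<bar>L x v - L y w\<bar> \<le> C * (norm (x - y) + norm (v - w))"
begin

section \<open>Grid equation versus lattice equation, and existence of discrete solutions\<close>

lemma finite_cost_sublevel:
  assumes "\<tau> > 0"
  shows "finite {l \<in> int_lattice. \<tau> * L z ((y + l - z) /\<^sub>R \<tau>) \<le> M}"
proof -
  obtain C where C: "\<And>x v. 1 * norm v - C \<le> L x v"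
    using L_superlinear[of 1] by blast
  have "{l \<in> int_lattice. \<tau> * L z ((y + l - z) /\<^sub>R \<tau>) \<le> M}
    \<subseteq> {l \<in> int_lattice. norm l \<le> M + \<tau> * C + norm (y - z)}"
  proof safe
    fix l assume M: "\<tau> * L z ((y + l - z) /\<^sub>R \<tau>) \<le> M"
    have "\<tau> * (norm ((y + l - z) /\<^sub>R \<tau>) - C) \<le> \<tau> * L z ((y + l - z) /\<^sub>R \<tau>)"
      using C[of "(y + l - z) /\<^sub>R \<tau>" z] assms by (intro mult_left_mono) auto
    then have "norm (y + l - z) - \<tau> * C \<le> M"
      using M assms by (simp add: right_diff_distrib flip: mult.assoc)
    moreover have "norm l \<le> norm (y + l - z) + norm (y - z)"
      using norm_triangle_ineq4[of "y + l - z" "y - z"] by (simp add: algebra_simps)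
    ultimately show "norm l \<le> M + \<tau> * C + norm (y - z)"
      by linarith
  qed
  then show ?thesis
    using finite_int_lattice_ball finite_subset by blast
qed

lemma lax_oleinik_eq_iff:
  assumes "N \<ge> 1" "\<tau> > 0"
  shows "lax_oleinik L N \<tau> u y = m \<longleftrightarrow>
    (\<forall>z\<in>grid N. \<forall>l\<in>int_lattice. m \<le> u z + \<tau> * L z ((y + l - z) /\<^sub>R \<tau>)) \<and>
    (\<exists>z\<in>grid N. \<exists>l\<in>int_lattice. u z + \<tau> * L z ((y + l - z) /\<^sub>R \<tau>) \<le> m)"
proof -
  define f where "f = (\<lambda>(z, l). u z + \<tau> * L z ((y + l - z) /\<^sub>R \<tau>))"
  define S where "S = (grid N :: (real^'n) set) \<times> (int_lattice :: (real^'n) set)"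
  have "S \<noteq> {}"
    using zero_in_grid[OF assms(1)] int_lattice_0 by (auto simp: S_def)
  moreover have "finite {s \<in> S. f s \<le> M}" for M
  proof -
    have "{s \<in> S. f s \<le> M}
      \<subseteq> (SIGMA z:grid N. {l \<in> int_lattice. \<tau> * L z ((y + l - z) /\<^sub>R \<tau>) \<le> M - u z})"
      by (auto simp: S_def f_def)
    then show ?thesis
      by (rule finite_subset) (intro finite_SigmaI finite_grid finite_cost_sublevel assms(2))
  qed
  ultimately obtain s where s: "s \<in> S" "\<And>t. t \<in> S \<Longrightarrow> f s \<le> f t"
    using minimum_attained_of_finite_sublevels[of S f] by blast
  have "(INF s\<in>S. f s) = f s"
    using s by (intro cInf_eq_minimum) auto
  then have eq: "lax_oleinik L N \<tau> u y = f s"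
    by (simp add: lax_oleinik_def S_def f_def)
  have "f s = m \<longleftrightarrow> (\<forall>t\<in>S. m \<le> f t) \<and> (\<exists>t\<in>S. f t \<le> m)"
  proof
    assume "f s = m"
    then show "(\<forall>t\<in>S. m \<le> f t) \<and> (\<exists>t\<in>S. f t \<le> m)"
      using s by auto
  next
    assume "(\<forall>t\<in>S. m \<le> f t) \<and> (\<exists>t\<in>S. f t \<le> m)"
    then obtain t where "m \<le> f s" "t \<in> S" "f t \<le> m"
      using s(1) by blast
    then show "f s = m"
      using s(2)[of t] by linarith
  qed
  then show ?thesis
    unfolding eq by (auto simp: S_def f_def)
qed

lemma discrete_solution_of_grid:
  assumes "N \<ge> 1" "\<tau> > 0" "\<forall>y\<in>grid N. lax_oleinik L N \<tau> u y = u y + \<tau> * c"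
  shows "discrete_solution L N \<tau> c (u \<circ> frac_vec)"
proof -
  have shift: "L (z - l) v = L z v" if "l \<in> int_lattice" for z l v
    using periodicD_minus[OF L_periodic that] by simp
  note T = assms(3)[unfolded lax_oleinik_eq_iff[OF assms(1,2)], rule_format]
  show ?thesis
    unfolding discrete_solution_def
  proof (intro conjI ballI)
    show "periodic (u \<circ> frac_vec)"
      by (rule periodic_comp_frac_vec)
  next
    fix y z :: "real^'n" assume yz: "y \<in> mesh_lattice N" "z \<in> mesh_lattice N"
    \<comment> \<open>With this shift, the step between the representatives equals the step between
      the lifts.\<close>
    define l where "l = (y - frac_vec y) - (z - frac_vec z)"
    have l: "l \<in> int_lattice"
      unfolding l_def by (intro int_lattice_diff frac_vec_diff)
    have "L (frac_vec z) = L z"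
      by (rule periodic_frac_vec[OF L_periodic])
    moreover have "frac_vec y + l - frac_vec z = y - z"
      by (simp add: l_def)
    ultimately show "(u \<circ> frac_vec) y + \<tau> * c \<le> (u \<circ> frac_vec) z + \<tau> * L z ((y - z) /\<^sub>R \<tau>)"
      using T[OF frac_vec_in_grid[OF assms(1) yz(1)]] frac_vec_in_grid[OF assms(1) yz(2)] l by force
  next
    fix y :: "real^'n" assume y: "y \<in> mesh_lattice N"
    obtain z l where zl: "z \<in> grid N" "l \<in> int_lattice"
      "u z + \<tau> * L z ((frac_vec y + l - z) /\<^sub>R \<tau>) \<le> u (frac_vec y) + \<tau> * c"
      using T[OF frac_vec_in_grid[OF assms(1) y]] by blast
    \<comment> \<open>The grid predecessor is lifted so that its displacement to \<open>y\<close> is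
      the one chosen on the grid.\<close>
    define m where "m = (y - frac_vec y) - l"
    have m: "m \<in> int_lattice"
      unfolding m_def by (intro int_lattice_diff frac_vec_diff zl)
    have "frac_vec (z + m) = z"
      using frac_vec_add[OF m] frac_vec_grid[OF zl(1)] by simp
    moreover have "L (z + m) = L z"
      by (rule periodicD[OF L_periodic m])
    moreover have "y - (z + m) = frac_vec y + l - z"
      by (simp add: m_def)
    moreover have "z + m \<in> mesh_lattice N"
      using zl(1) grid_subset_mesh_lattice m mesh_lattice_add_int by blast
    ultimately have "z + m \<in> mesh_lattice N"
      "(u \<circ> frac_vec) (z + m) + \<tau> * L (z + m) ((y - (z + m)) /\<^sub>R \<tau>) \<le> (u \<circ> frac_vec) y + \<tau> * c"
      using zl(3) by (auto simp only: o_apply)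
    then show "\<exists>z\<in>mesh_lattice N. (u \<circ> frac_vec) z + \<tau> * L z ((y - z) /\<^sub>R \<tau>)
        \<le> (u \<circ> frac_vec) y + \<tau> * c"
      by blast
  qed
qed

text \<open>Minimizing over the shift first leaves one cost per ordered pair of grid points, a
  finite min-plus matrix. Its eigenvalue is the increment per step, whence the division by
  \<open>\<tau>\<close>.\<close>

lemma lax_oleinik_eigenvector:
  assumes "N \<ge> 1" "\<tau> > 0"
  obtains c u where "\<forall>y\<in>grid N. lax_oleinik L N \<tau> u y = u y + \<tau> * c"
proof -
  have "\<exists>l\<in>int_lattice. \<forall>m\<in>int_lattice.
      \<tau> * L z ((y + l - z) /\<^sub>R \<tau>) \<le> \<tau> * L z ((y + m - z) /\<^sub>R \<tau>)" for z y
  proof (rule minimum_attained_of_finite_sublevels[of int_lattice "\<lambda>l. \<tau> * L z ((y + l - z) /\<^sub>R \<tau>)"])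
    show "(int_lattice :: (real^'n) set) \<noteq> {}"
      using int_lattice_0 by blast
    show "finite {l \<in> int_lattice. \<tau> * L z ((y + l - z) /\<^sub>R \<tau>) \<le> M}" for M
      by (rule finite_cost_sublevel[OF assms(2)])
  qed blast
  then obtain s where s: "\<And>z y. s z y \<in> int_lattice"
    "\<And>z y m. m \<in> int_lattice \<Longrightarrow>
      \<tau> * L z ((y + s z y - z) /\<^sub>R \<tau>) \<le> \<tau> * L z ((y + m - z) /\<^sub>R \<tau>)"
    by metis
  obtain c u where cu:
    "\<And>y z. y \<in> grid N \<Longrightarrow> z \<in> grid N \<Longrightarrow> u y + c \<le> u z + \<tau> * L z ((y + s z y - z) /\<^sub>R \<tau>)"
    "\<And>y. y \<in> grid N \<Longrightarrow> \<exists>z\<in>grid N. u z + \<tau> * L z ((y + s z y - z) /\<^sub>R \<tau>) \<le> u y + c"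
  proof (rule min_plus_eigenvector[OF finite_grid, where W = "\<lambda>z y. \<tau> * L z ((y + s z y - z) /\<^sub>R \<tau>)"])
    show "(grid N :: (real^'n) set) \<noteq> {}"
      using zero_in_grid[OF assms(1)] by blast
  qed blast
  have "lax_oleinik L N \<tau> u y = u y + \<tau> * (c / \<tau>)" if "y \<in> grid N" for y
    unfolding lax_oleinik_eq_iff[OF assms]
  proof (intro conjI ballI)
    fix z l :: "real^'n" assume "z \<in> grid N" "l \<in> int_lattice"
    then have "u y + c \<le> u z + \<tau> * L z ((y + l - z) /\<^sub>R \<tau>)"
      using cu(1)[OF that, of z] s(2)[of l z y] by linarith
    then show "u y + \<tau> * (c / \<tau>) \<le> u z + \<tau> * L z ((y + l - z) /\<^sub>R \<tau>)"
      using assms(2) by simp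
  next
    show "\<exists>z\<in>grid N. \<exists>l\<in>int_lattice. u z + \<tau> * L z ((y + l - z) /\<^sub>R \<tau>) \<le> u y + \<tau> * (c / \<tau>)"
      using cu(2)[OF that] s(1) assms(2) by auto
  qed
  then show ?thesis using that by blast
qed

lemma discrete_solution_discrete_critical_value:
  assumes "N \<ge> 1" "\<tau> > 0"
  obtains u where "discrete_solution L N \<tau> (discrete_critical_value L N \<tau>) u"
proof -
  obtain c u where cu: "\<forall>y\<in>grid N. lax_oleinik L N \<tau> u y = u y + \<tau> * c"
    using lax_oleinik_eigenvector[OF assms] .
  have "discrete_critical_value L N \<tau> = c"
    unfolding discrete_critical_value_def
    using cu discrete_solution_of_grid[OF assms] discrete_solution_value_unique[OF assms]
    by (intro the_equality) blast+
  then show ?thesis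
    using that discrete_solution_of_grid[OF assms cu] by blast
qed

end

subsection \<open>Uniform estimates for discrete solutions\<close>

lemma norm_divideR_le_iff:
  fixes x :: "'a::real_normed_vector"
  shows "t > 0 \<Longrightarrow> norm (x /\<^sub>R t) \<le> R \<longleftrightarrow> norm x \<le> R * t"
  by (simp add: divide_inverse_commute[symmetric] pos_divide_le_eq)

lemma discrete_solution_chain:
  assumes "discrete_solution L N \<tau> c u" "\<And>i. p i \<in> mesh_lattice N"
  shows "u (p n) + real n * (\<tau> * c) \<le> u (p 0) + (\<Sum>i<n. \<tau> * L (p i) ((p (Suc i) - p i) /\<^sub>R \<tau>))"
proof (induction n)
  case (Suc n)
  have "u (p (Suc n)) + \<tau> * c \<le> u (p n) + \<tau> * L (p n) ((p (Suc n) - p n) /\<^sub>R \<tau>)"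
    using assms by (auto simp: discrete_solution_def)
  then show ?case
    using Suc by (simp add: algebra_simps)
qed simp

text \<open>The chain rounds equally spaced points of the segment. Each moves by at most
  \<open>CARD('n) / N\<close>, so each velocity is off the mean one by at most twice this over
  \<open>\<tau>\<close>; the ends are lattice points and stay put. The cost bound is left open
  because it is used once with a crude constant and once with a Lipschitz estimate.\<close>

lemma discrete_solution_straight_chain:
  fixes L :: "real^'n \<Rightarrow> real^'n \<Rightarrow> real"
  assumes "discrete_solution L N \<tau> c u" "N \<ge> 1" "\<tau> > 0" "n \<ge> 1"
    and "x \<in> mesh_lattice N" "y \<in> mesh_lattice N"
    and bound: "\<And>q w. norm (q - x) \<le> norm (y - x) + real CARD('n) / real N \<Longrightarrow>
      norm (w - (y - x) /\<^sub>R (real n * \<tau>)) \<le> 2 * (real CARD('n) / real N) / \<tau> \<Longrightarrow> L q w \<le> K"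
  shows "u y - u x \<le> real n * \<tau> * (K - c)"
proof -
  define q where "q i = x + (real i / real n) *\<^sub>R (y - x)" for i
  define p where "p i = mesh_floor N (q i)" for i
  have p: "p i \<in> mesh_lattice N" for i
    unfolding p_def by (rule mesh_floor_in[OF assms(2)])
  have p0: "p 0 = x" and pn: "p n = y"
    using assms mesh_floor_id by (auto simp: p_def q_def)
  have pq: "norm (p i - q i) \<le> real CARD('n) / real N" for i
    unfolding p_def by (rule norm_mesh_floor_diff[OF assms(2)])
  have "L (p i) ((p (Suc i) - p i) /\<^sub>R \<tau>) \<le> K" if "i < n" for i
  proof (rule bound)
    have "norm (q i - x) \<le> norm (y - x)"
      using that mult_left_le_one_le[of "norm (y - x)" "real i / real n"] by (simp add: q_def)
    then show "norm (p i - x) \<le> norm (y - x) + real CARD('n) / real N"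
      using norm_triangle_ineq[of "p i - q i" "q i - x"] pq[of i] by simp
    have "q (Suc i) - q i = (y - x) /\<^sub>R real n"
      using assms(4) by (simp add: q_def inverse_eq_divide flip: scaleR_left_diff_distrib diff_divide_distrib)
    then have "(q (Suc i) - q i) /\<^sub>R \<tau> = (y - x) /\<^sub>R (real n * \<tau>)"
      by (simp add: mult.commute)
    then have "(p (Suc i) - p i) /\<^sub>R \<tau> - (y - x) /\<^sub>R (real n * \<tau>)
        = ((p (Suc i) - q (Suc i)) - (p i - q i)) /\<^sub>R \<tau>"
      by (simp flip: scaleR_diff_right) (simp add: algebra_simps)
    moreover have "norm ((p (Suc i) - q (Suc i)) - (p i - q i)) \<le> 2 * (real CARD('n) / real N)"
      using norm_triangle_ineq4[of "p (Suc i) - q (Suc i)" "p i - q i"] pq[of i] pq[of "Suc i"]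
      by linarith
    ultimately show "norm ((p (Suc i) - p i) /\<^sub>R \<tau> - (y - x) /\<^sub>R (real n * \<tau>))
        \<le> 2 * (real CARD('n) / real N) / \<tau>"
      using assms(3) by (simp add: divide_inverse_commute mult_left_mono)
  qed
  then have "(\<Sum>i<n. \<tau> * L (p i) ((p (Suc i) - p i) /\<^sub>R \<tau>)) \<le> (\<Sum>i<n. \<tau> * K)"
    using assms(3) by (intro sum_mono mult_left_mono) auto
  then show ?thesis
    using discrete_solution_chain[OF assms(1), of p n] p p0 pn by (simp add: algebra_simps)
qed

context tonelli_lagrangian
begin

text \<open>Constant functions are barriers: standing still bounds \<open>c\<close> from above by a
  bound on \<open>L x 0\<close>, and a lower bound of \<open>L\<close> bounds it from below.\<close>

lemma discrete_value_bounded: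
  obtains C where "C \<ge> 0"
    "\<And>N \<tau> c u. N \<ge> 1 \<Longrightarrow> \<tau> > 0 \<Longrightarrow> discrete_solution L N \<tau> c u \<Longrightarrow> \<bar>c\<bar> \<le> C"
proof -
  obtain A where A: "\<And>x v. 1 * norm v - A \<le> L x v"
    using L_superlinear[of 1] by blast
  obtain B where B: "\<And>x v. norm v \<le> 0 \<Longrightarrow> L x v \<le> B"
    using L_bounded[of 0] by blast
  have "\<bar>c\<bar> \<le> \<bar>A\<bar> + \<bar>B\<bar>" if *: "N \<ge> 1" "\<tau> > 0" "discrete_solution L N \<tau> c u" for N \<tau> c u
  proof -
    have "- A \<le> c"
    proof (rule subsolution_le_discrete_value[OF *, of "\<lambda>_. 0"])
      fix y z :: "real^'n"
      have "- A \<le> L z ((y - z) /\<^sub>R \<tau>)"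
        using A[of "(y - z) /\<^sub>R \<tau>" z] norm_ge_zero[of "(y - z) /\<^sub>R \<tau>"] by linarith
      then show "0 + \<tau> * - A \<le> 0 + \<tau> * L z ((y - z) /\<^sub>R \<tau>)"
        using mult_left_mono[of "- A" _ \<tau>] *(2) by simp
    qed (simp add: periodic_def)
    moreover have "c \<le> B"
    proof (rule discrete_value_le_supersolution[OF *, of "\<lambda>_. 0"])
      fix y :: "real^'n" assume "y \<in> mesh_lattice N"
      then show "\<exists>z\<in>mesh_lattice N. 0 + \<tau> * L z ((y - z) /\<^sub>R \<tau>) \<le> 0 + \<tau> * B"
        using B[of 0 y] *(2) by (intro bexI[of _ y]) auto
    qed (simp add: periodic_def)
    ultimately show ?thesis by linarith
  qed
  then show ?thesis
    using that[of "\<bar>A\<bar> + \<bar>B\<bar>"] by simp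
qed

text \<open>A straight chain of mean speed at most 1 costs \<open>O(1)\<close> per unit time. At
  least one step must be made, which produces the extra \<open>\<tau>\<close> for nearby
  points.\<close>

lemma discrete_solution_almost_lipschitz:
  obtains C where "C \<ge> 0"
    "\<And>N \<tau> c u y z. N \<ge> 1 \<Longrightarrow> \<tau> > 0 \<Longrightarrow> 1 / real N \<le> \<tau> \<Longrightarrow> discrete_solution L N \<tau> c u \<Longrightarrow>
      y \<in> mesh_lattice N \<Longrightarrow> z \<in> mesh_lattice N \<Longrightarrow> u y - u z \<le> C * (norm (y - z) + \<tau>)"
proof -
  define d where "d = real CARD('n)"
  have d: "d \<ge> 0" by (simp add: d_def)
  obtain C0 where C0: "C0 \<ge> 0"
    "\<And>N \<tau> c u. N \<ge> 1 \<Longrightarrow> \<tau> > 0 \<Longrightarrow> discrete_solution L N \<tau> c u \<Longrightarrow> \<bar>c\<bar> \<le> C0"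
    using discrete_value_bounded by blast
  obtain K where K: "\<And>x v. norm v \<le> 1 + 2 * d \<Longrightarrow> L x v \<le> K"
    using L_bounded[of "1 + 2 * d"] by blast
  have "u y - u z \<le> (2 * (\<bar>K\<bar> + C0)) * (norm (y - z) + \<tau>)"
    if *: "N \<ge> 1" "\<tau> > 0" "1 / real N \<le> \<tau>" "discrete_solution L N \<tau> c u"
      "y \<in> mesh_lattice N" "z \<in> mesh_lattice N" for N \<tau> c u y z
  proof -
    \<comment> \<open>Enough steps for speed at most 1. The added 1 keeps \<open>n\<close> positive
      when \<open>y = z\<close>; the total time is still at most
      \<open>norm (y - z) + 2 * \<tau>\<close>.\<close>
    define n where "n = nat \<lceil>norm (y - z) / \<tau>\<rceil> + 1"
    have n: "n \<ge> 1"
      by (simp add: n_def)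
    have "0 \<le> norm (y - z) / \<tau>"
      using *(2) by simp
    then have n1: "norm (y - z) / \<tau> \<le> real n" and n2: "real n \<le> norm (y - z) / \<tau> + 2"
      unfolding n_def by linarith+
    from n1 n2 have n1': "norm (y - z) \<le> real n * \<tau>" and n2': "real n * \<tau> \<le> norm (y - z) + 2 * \<tau>"
      using *(2) by (simp_all add: field_simps)
    have "u y - u z \<le> real n * \<tau> * (K - c)"
    proof (rule discrete_solution_straight_chain[OF *(4,1,2) n *(6,5)])
      fix q w :: "real^'n"
      assume w: "norm (w - (y - z) /\<^sub>R (real n * \<tau>)) \<le> 2 * (real CARD('n) / real N) / \<tau>"
      have "norm ((y - z) /\<^sub>R (real n * \<tau>)) \<le> 1"
        using n1' n *(2) by (subst norm_divideR_le_iff) auto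
      moreover have "2 * (real CARD('n) / real N) / \<tau> \<le> 2 * d"
      proof -
        have "2 * (real CARD('n) / real N) / \<tau> = 2 * d * (1 / real N) / \<tau>"
          by (simp add: d_def)
        also have "\<dots> \<le> 2 * d * \<tau> / \<tau>"
          using d *(2,3) by (intro divide_right_mono mult_left_mono) auto
        finally show ?thesis using *(2) by simp
      qed
      moreover have "norm w \<le> norm (w - (y - z) /\<^sub>R (real n * \<tau>)) + norm ((y - z) /\<^sub>R (real n * \<tau>))"
        using norm_triangle_sub[of w "(y - z) /\<^sub>R (real n * \<tau>)"] by (simp only: add.commute)
      ultimately have "norm w \<le> 1 + 2 * d"
        using w by linarith
      then show "L q w \<le> K"
        by (rule K)
    qed
    also have "\<dots> \<le> real n * \<tau> * (\<bar>K\<bar> + C0)"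
      using C0(2)[OF *(1,2,4)] *(2) by (intro mult_left_mono) auto
    also have "\<dots> \<le> (2 * (norm (y - z) + \<tau>)) * (\<bar>K\<bar> + C0)"
    proof (rule mult_right_mono)
      show "real n * \<tau> \<le> 2 * (norm (y - z) + \<tau>)"
        by (rule order.trans[OF n2']) (simp add: distrib_left)
    qed (use C0(1) in auto)
    finally show ?thesis by (simp only: mult_ac)
  qed
  then show ?thesis
    using that[of "2 * (\<bar>K\<bar> + C0)"] C0(1) by simp
qed

text \<open>The cost of a step grows with slope \<open>C1 + 1\<close> in its length, while the gain
  \<open>u y - u z\<close> has slope at most \<open>C1\<close>. The surplus
  \<open>norm (y - z)\<close> is therefore of order \<open>\<tau>\<close>.\<close>

lemma optimal_step_bounded:
  obtains R where "R \<ge> 0"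
    "\<And>N \<tau> c u y z. N \<ge> 1 \<Longrightarrow> \<tau> > 0 \<Longrightarrow> 1 / real N \<le> \<tau> \<Longrightarrow> discrete_solution L N \<tau> c u \<Longrightarrow>
      y \<in> mesh_lattice N \<Longrightarrow> z \<in> mesh_lattice N \<Longrightarrow>
      u z + \<tau> * L z ((y - z) /\<^sub>R \<tau>) \<le> u y + \<tau> * c \<Longrightarrow> norm (y - z) \<le> R * \<tau>"
proof -
  obtain C0 where C0: "C0 \<ge> 0"
    "\<And>N \<tau> c u. N \<ge> 1 \<Longrightarrow> \<tau> > 0 \<Longrightarrow> discrete_solution L N \<tau> c u \<Longrightarrow> \<bar>c\<bar> \<le> C0"
    using discrete_value_bounded by blast
  obtain C1 where C1: "C1 \<ge> 0"
    "\<And>N \<tau> c u y z. N \<ge> 1 \<Longrightarrow> \<tau> > 0 \<Longrightarrow> 1 / real N \<le> \<tau> \<Longrightarrow> discrete_solution L N \<tau> c u \<Longrightarrow>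
      y \<in> mesh_lattice N \<Longrightarrow> z \<in> mesh_lattice N \<Longrightarrow> u y - u z \<le> C1 * (norm (y - z) + \<tau>)"
    using discrete_solution_almost_lipschitz by blast
  obtain A where A: "\<And>x v. (C1 + 1) * norm v - A \<le> L x v"
    using L_superlinear[of "C1 + 1"] by blast
  have "norm (y - z) \<le> (\<bar>A\<bar> + C1 + C0) * \<tau>"
    if *: "N \<ge> 1" "\<tau> > 0" "1 / real N \<le> \<tau>" "discrete_solution L N \<tau> c u"
      "y \<in> mesh_lattice N" "z \<in> mesh_lattice N" and
      opt: "u z + \<tau> * L z ((y - z) /\<^sub>R \<tau>) \<le> u y + \<tau> * c" for N \<tau> c u y z
  proof -
    have "\<tau> * ((C1 + 1) * norm ((y - z) /\<^sub>R \<tau>) - A) \<le> \<tau> * L z ((y - z) /\<^sub>R \<tau>)"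
      using A[of "(y - z) /\<^sub>R \<tau>" z] *(2) by (intro mult_left_mono) auto
    moreover have "\<tau> * ((C1 + 1) * norm ((y - z) /\<^sub>R \<tau>) - A) = (C1 + 1) * norm (y - z) - \<tau> * A"
      using *(2) by (simp add: right_diff_distrib mult.left_commute[of \<tau>] flip: mult.assoc)
    moreover have "\<tau> * A \<le> \<tau> * \<bar>A\<bar>" "\<tau> * c \<le> \<tau> * C0"
      using C0(2)[OF *(1,2,4)] *(2) by (auto intro!: mult_left_mono)
    ultimately show ?thesis
      using opt C1(2)[OF *] by (simp add: algebra_simps)
  qed
  then show ?thesis
    using that[of "\<bar>A\<bar> + C1 + C0"] C0(1) C1(1) by simp
qed

text \<open>With total time \<open>t = n * \<tau>\<close>, the straight chain stays within
  \<open>O(t)\<close> of \<open>x\<close>, and its velocities within \<open>O(h/\<tau>)\<close> of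
  the mean one; the Lipschitz bound of \<open>L\<close> turns both into an error per unit time. The
  speed bound \<open>R\<close> fixes the ball of velocities, so \<open>C\<close> depends on
  it.\<close>

lemma discrete_solution_subaction:
  obtains C where "C \<ge> 0"
    "\<And>N \<tau> c u n x y. N \<ge> 1 \<Longrightarrow> \<tau> > 0 \<Longrightarrow> 1 / real N \<le> \<tau> \<Longrightarrow> discrete_solution L N \<tau> c u \<Longrightarrow>
      n \<ge> 1 \<Longrightarrow> x \<in> mesh_lattice N \<Longrightarrow> y \<in> mesh_lattice N \<Longrightarrow> norm (y - x) \<le> R * (real n * \<tau>) \<Longrightarrow>
      u y - u x \<le> real n * \<tau> *
        (L x ((y - x) /\<^sub>R (real n * \<tau>)) + C * (real n * \<tau> + 1 / real N / \<tau>) - c)"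
proof -
  define d where "d = real CARD('n)"
  have d: "d \<ge> 0" by (simp add: d_def)
  obtain C where C: "C \<ge> 0" "\<And>x y v w. norm v \<le> \<bar>R\<bar> + 2 * d \<Longrightarrow> norm w \<le> \<bar>R\<bar> + 2 * d \<Longrightarrow>
      \<bar>L x v - L y w\<bar> \<le> C * (norm (x - y) + norm (v - w))"
    using L_lipschitz[of "\<bar>R\<bar> + 2 * d"] by blast
  have "u y - u x \<le> real n * \<tau> * (L x ((y - x) /\<^sub>R (real n * \<tau>))
      + (C * (\<bar>R\<bar> + 3 * d)) * (real n * \<tau> + 1 / real N / \<tau>) - c)"
    if *: "N \<ge> 1" "\<tau> > 0" "1 / real N \<le> \<tau>" "discrete_solution L N \<tau> c u" "n \<ge> 1"
      "x \<in> mesh_lattice N" "y \<in> mesh_lattice N" and R: "norm (y - x) \<le> R * (real n * \<tau>)"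
    for N \<tau> c u n x y
  proof (rule discrete_solution_straight_chain[OF *(4,1,2,5-7)])
    fix q w :: "real^'n"
    define v where "v = (y - x) /\<^sub>R (real n * \<tau>)"
    assume q: "norm (q - x) \<le> norm (y - x) + real CARD('n) / real N"
      and w: "norm (w - (y - x) /\<^sub>R (real n * \<tau>)) \<le> 2 * (real CARD('n) / real N) / \<tau>"
    have n\<tau>: "\<tau> \<le> real n * \<tau>"
      using *(2,5) by simp
    have "norm v \<le> R"
      using R *(2,5) unfolding v_def by (subst norm_divideR_le_iff) auto
    then have v: "norm v \<le> \<bar>R\<bar>" by linarith
    have w': "norm (w - v) \<le> 2 * d * (1 / real N / \<tau>)"
      using w by (simp add: v_def d_def)
    also have "\<dots> \<le> 2 * d * (\<tau> / \<tau>)"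
      using d *(2,3) by (intro divide_right_mono mult_left_mono) auto
    finally have "norm w \<le> \<bar>R\<bar> + 2 * d"
      using v *(2) norm_triangle_ineq[of "w - v" v] by simp
    then have "L q w - L x v \<le> C * (norm (q - x) + norm (w - v))"
      using C(2)[of w v q x] v d by linarith
    also have "norm (q - x) \<le> (\<bar>R\<bar> + d) * (real n * \<tau>)"
    proof -
      have "R * (real n * \<tau>) \<le> \<bar>R\<bar> * (real n * \<tau>)"
        using *(2) by (intro mult_right_mono) auto
      moreover have "d * (1 / real N) \<le> d * (real n * \<tau>)"
        using d *(3) n\<tau> by (intro mult_left_mono) auto
      ultimately show ?thesis
        using q R by (simp add: d_def algebra_simps)
    qed
    also note w'
    also have "(\<bar>R\<bar> + d) * (real n * \<tau>) + 2 * d * (1 / real N / \<tau>)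
        \<le> (\<bar>R\<bar> + 3 * d) * (real n * \<tau>) + (\<bar>R\<bar> + 3 * d) * (1 / real N / \<tau>)"
      using d *(2) by (intro add_mono mult_right_mono) auto
    finally have "L q w - L x v \<le> C * ((\<bar>R\<bar> + 3 * d) * (real n * \<tau> + 1 / real N / \<tau>))"
      using C(1) by (simp add: mult_left_mono distrib_left)
    then show "L q w \<le> L x ((y - x) /\<^sub>R (real n * \<tau>))
        + (C * (\<bar>R\<bar> + 3 * d)) * (real n * \<tau> + 1 / real N / \<tau>)"
      by (simp add: v_def mult.assoc)
  qed
  then show ?thesis
    using that[of "C * (\<bar>R\<bar> + 3 * d)"] C(1) d by simp
qed

text \<open>Follow optimal predecessors backwards. Bounded steps keep the chain within
  \<open>O(t)\<close> of its starting point, so \<open>L\<close> may be evaluated there at every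
  step, and Jensen's inequality replaces the mean cost by the cost of the mean velocity. The chain
  already lies in the lattice; without rounding, no error \<open>h/\<tau>\<close> appears.\<close>

lemma discrete_solution_calibrated:
  obtains R C where "R \<ge> 0" "C \<ge> 0"
    "\<And>N \<tau> c u n y. N \<ge> 1 \<Longrightarrow> \<tau> > 0 \<Longrightarrow> 1 / real N \<le> \<tau> \<Longrightarrow> discrete_solution L N \<tau> c u \<Longrightarrow>
      n \<ge> 1 \<Longrightarrow> y \<in> mesh_lattice N \<Longrightarrow>
      \<exists>x\<in>mesh_lattice N. norm (y - x) \<le> R * (real n * \<tau>) \<and>
        u x + real n * \<tau> * L x ((y - x) /\<^sub>R (real n * \<tau>)) \<le> u y + real n * \<tau> * (c + C * (real n * \<tau>))"
proof -
  obtain R where R: "R \<ge> 0"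
    "\<And>N \<tau> c u y z. N \<ge> 1 \<Longrightarrow> \<tau> > 0 \<Longrightarrow> 1 / real N \<le> \<tau> \<Longrightarrow> discrete_solution L N \<tau> c u \<Longrightarrow>
      y \<in> mesh_lattice N \<Longrightarrow> z \<in> mesh_lattice N \<Longrightarrow>
      u z + \<tau> * L z ((y - z) /\<^sub>R \<tau>) \<le> u y + \<tau> * c \<Longrightarrow> norm (y - z) \<le> R * \<tau>"
    using optimal_step_bounded by blast
  obtain C where C: "C \<ge> 0" "\<And>x y v w. norm v \<le> R \<Longrightarrow> norm w \<le> R \<Longrightarrow>
      \<bar>L x v - L y w\<bar> \<le> C * (norm (x - y) + norm (v - w))"
    using L_lipschitz[of R] by blast
  have "\<exists>x\<in>mesh_lattice N. norm (y - x) \<le> R * (real n * \<tau>) \<and>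
        u x + real n * \<tau> * L x ((y - x) /\<^sub>R (real n * \<tau>)) \<le> u y + real n * \<tau> * (c + C * R * (real n * \<tau>))"
    if *: "N \<ge> 1" "\<tau> > 0" "1 / real N \<le> \<tau>" "discrete_solution L N \<tau> c u"
      and n: "n \<ge> 1" and y: "y \<in> mesh_lattice N" for N \<tau> c u n y
  proof -
    have "\<forall>y\<in>mesh_lattice N. \<exists>z\<in>mesh_lattice N. u z + \<tau> * L z ((y - z) /\<^sub>R \<tau>) \<le> u y + \<tau> * c"
      using *(4) by (simp add: discrete_solution_def)
    then obtain prd where prd: "\<And>y. y \<in> mesh_lattice N \<Longrightarrow> prd y \<in> mesh_lattice N"
      "\<And>y. y \<in> mesh_lattice N \<Longrightarrow> u (prd y) + \<tau> * L (prd y) ((y - prd y) /\<^sub>R \<tau>) \<le> u y + \<tau> * c"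
      by metis
    define z where "z j = (prd ^^ j) y" for j
    have z: "z j \<in> mesh_lattice N" for j
      by (induction j) (auto simp: z_def y prd(1))
    have z0: "z 0 = y"
      by (simp add: z_def)
    \<comment> \<open>Indices run against time: step \<open>j\<close> leads from
      \<open>z (Suc j)\<close> to \<open>z j\<close>, so the path starts at
      \<open>z n\<close>.\<close>
    define v where "v j = (z j - z (Suc j)) /\<^sub>R \<tau>" for j
    have step: "u (z (Suc j)) + \<tau> * L (z (Suc j)) (v j) \<le> u (z j) + \<tau> * c" for j
      using prd(2)[OF z[of j]] by (simp add: z_def v_def)
    have zz: "norm (z j - z (Suc j)) \<le> R * \<tau>" for j
      using R(2)[OF * z z step[unfolded v_def]] .
    have v: "norm (v j) \<le> R" for j
      using zz[of j] *(2) unfolding v_def by (subst norm_divideR_le_iff) auto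
    have far: "norm (z j - z (j + k)) \<le> R * (real k * \<tau>)" for j k
    proof (induction k)
      case (Suc k)
      then show ?case
        using norm_triangle_ineq[of "z j - z (j + k)" "z (j + k) - z (Suc (j + k))"] zz[of "j + k"]
        by (simp add: algebra_simps)
    qed simp
    have near: "norm (z j - z n) \<le> R * (real n * \<tau>)" if "j \<le> n" for j
    proof -
      have "norm (z j - z n) \<le> R * (real (n - j) * \<tau>)"
        using far[of j "n - j"] that by simp
      also have "\<dots> \<le> R * (real n * \<tau>)"
        using R(1) *(2) by (intro mult_left_mono mult_right_mono) auto
      finally show ?thesis .
    qed
    have "u (z k) + (\<Sum>j<k. \<tau> * L (z (Suc j)) (v j)) \<le> u y + real k * (\<tau> * c)" for k
    proof (induction k)
      case (Suc k)
      then show ?case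
        using step[of k] by (simp add: algebra_simps)
    qed (simp add: z0)
    then have total: "u (z n) + (\<Sum>j<n. \<tau> * L (z (Suc j)) (v j)) \<le> u y + real n * (\<tau> * c)" .
    have vsum: "(\<Sum>j<n. (1 / real n) *\<^sub>R v j) = (y - z n) /\<^sub>R (real n * \<tau>)"
    proof -
      have "(\<Sum>j<n. z j - z (Suc j)) = y - z n"
        by (simp add: sum_lessThan_telescope' z0)
      then show ?thesis
        by (simp add: v_def divide_inverse mult.commute flip: scaleR_sum_right)
    qed
    have "L (z n) (\<Sum>j<n. (1 / real n) *\<^sub>R v j) \<le> (\<Sum>j<n. (1 / real n) * L (z n) (v j))"
      using n by (intro convex_on_sum[OF _ _ L_convex]) (auto simp: lessThan_empty_iff)
    then have "L (z n) ((y - z n) /\<^sub>R (real n * \<tau>)) \<le> (\<Sum>j<n. L (z n) (v j)) / real n"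
      by (simp add: vsum flip: sum_divide_distrib)
    then have "real n * \<tau> * L (z n) ((y - z n) /\<^sub>R (real n * \<tau>)) \<le> \<tau> * (\<Sum>j<n. L (z n) (v j))"
      using n *(2) by (simp add: field_simps)
    also have "\<dots> \<le> (\<Sum>j<n. \<tau> * (L (z (Suc j)) (v j) + C * (R * (real n * \<tau>))))"
      unfolding sum_distrib_left
    proof (intro sum_mono mult_left_mono)
      fix j assume "j \<in> {..<n}"
      then have "C * norm (z (Suc j) - z n) \<le> C * (R * (real n * \<tau>))"
        using near[of "Suc j"] C(1) by (intro mult_left_mono) auto
      then show "L (z n) (v j) \<le> L (z (Suc j)) (v j) + C * (R * (real n * \<tau>))"
        using C(2)[OF v v, of "z (Suc j)" j "z n" j] by simp
    qed (use *(2) in auto)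
    also have "\<dots> = (\<Sum>j<n. \<tau> * L (z (Suc j)) (v j)) + real n * \<tau> * (C * R * (real n * \<tau>))"
      by (simp add: distrib_left sum.distrib)
    finally show ?thesis
      using total z near[of 0] by (intro bexI[of _ "z n"]) (auto simp: z0 algebra_simps)
  qed
  then show ?thesis
    using that[of R "C * R"] R(1) C(1) by simp
qed

end

subsection \<open>The vanishing-mesh limit\<close>

text \<open>
  A substitute for the weak KAM equation \<open>u = T\<^sub>t u + t \<alpha>\<close>: the action of a curve over time \<open>t\<close> is
  replaced by \<open>t L\<close> along the segment, at the cost of an error \<open>O(t\<^sup>2)\<close>.
\<close>

definition (in tonelli_lagrangian) weak_kam :: "real \<Rightarrow> (real^'n \<Rightarrow> real) \<Rightarrow> bool" where
  "weak_kam c u \<longleftrightarrow> periodic u \<and>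
    (\<exists>K\<ge>0. \<forall>x y. u y - u x \<le> K * norm (y - x)) \<and>
    (\<forall>R. \<exists>C\<ge>0. \<forall>t x y. t > 0 \<longrightarrow> norm (y - x) \<le> R * t \<longrightarrow>
      u y - u x \<le> t * (L x ((y - x) /\<^sub>R t) + C * t - c)) \<and>
    (\<exists>R\<ge>0. \<exists>C\<ge>0. \<forall>t y. t > 0 \<longrightarrow>
      (\<exists>x. norm (y - x) \<le> R * t \<and> u x + t * L x ((y - x) /\<^sub>R t) \<le> u y + t * (c + C * t)))"

section \<open>Limits of normalized solutions on finer and finer meshes\<close>

lemma (in tonelli_lagrangian) L_tendsto:
  assumes "(p \<longlongrightarrow> x) F" "(q \<longlongrightarrow> v) F"
  shows "((\<lambda>k. L (p k) (q k)) \<longlongrightarrow> L x v) F"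
proof -
  obtain C where C: "\<And>x y v' w. norm v' \<le> norm v + 1 \<Longrightarrow> norm w \<le> norm v + 1 \<Longrightarrow>
      \<bar>L x v' - L y w\<bar> \<le> C * (norm (x - y) + norm (v' - w))"
    using L_lipschitz[of "norm v + 1"] by blast
  have "\<forall>\<^sub>F k in F. dist (q k) v < 1"
    using assms(2) by (auto simp: tendsto_iff)
  then have bound: "\<forall>\<^sub>F k in F. norm (L (p k) (q k) - L x v) \<le> C * (norm (p k - x) + norm (q k - v))"
  proof (rule eventually_mono)
    fix k assume "dist (q k) v < 1"
    then have "norm (q k) \<le> norm v + 1"
      using norm_triangle_sub[of "q k" v] by (simp add: dist_norm)
    then show "norm (L (p k) (q k) - L x v) \<le> C * (norm (p k - x) + norm (q k - v))"
      unfolding real_norm_def by (rule C) linarith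
  qed
  have "((\<lambda>k. C * (norm (p k - x) + norm (q k - v))) \<longlongrightarrow> C * (norm (x - x) + norm (v - v))) F"
    by (intro tendsto_intros assms)
  then have "((\<lambda>k. C * (norm (p k - x) + norm (q k - v))) \<longlongrightarrow> 0) F"
    by simp
  then have "((\<lambda>k. L (p k) (q k) - L x v) \<longlongrightarrow> 0) F"
    by (rule Lim_null_comparison[OF bound])
  then show ?thesis
    by (rule Lim_null[THEN iffD2])
qed

text \<open>Solutions are determined at best up to constants. Fixing the value 0 at the origin turns
  the almost-Lipschitz bound into boundedness at every point, as the lower limit requires.\<close>

locale vanishing_mesh = tonelli_lagrangian L for L :: "real^'n \<Rightarrow> real^'n \<Rightarrow> real" +
  fixes N :: "nat \<Rightarrow> nat" and \<tau> c :: "nat \<Rightarrow> real" and u :: "nat \<Rightarrow> real^'n \<Rightarrow> real" and c_lim :: real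
  assumes N: "N k \<ge> 1" and \<tau>: "\<tau> k > 0" and N\<tau>: "1 / real (N k) \<le> \<tau> k"
    and solution: "discrete_solution L (N k) (\<tau> k) (c k) (u k)"
    and normalized: "u k 0 = 0"
    and \<tau>_lim: "\<tau> \<longlonglongrightarrow> 0" and ratio_lim: "(\<lambda>k. 1 / real (N k) / \<tau> k) \<longlonglongrightarrow> 0"
    and c_lim: "c \<longlonglongrightarrow> c_lim"
begin

definition sample :: "real^'n \<Rightarrow> nat \<Rightarrow> real" where
  "sample x k = u k (mesh_floor (N k) x)"

definition limit_solution :: "real^'n \<Rightarrow> real" where
  "limit_solution x = real_liminf (sample x)"

lemma mesh_lim: "(\<lambda>k. 1 / real (N k)) \<longlonglongrightarrow> 0"
  by (rule tendsto_sandwich[OF _ _ tendsto_const \<tau>_lim]) (use N\<tau> in auto)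

lemma floor_in: "mesh_floor (N k) x \<in> mesh_lattice (N k)"
  by (rule mesh_floor_in[OF N])

lemma floor_lim:
  fixes x :: "real^'n"
  shows "(\<lambda>k. mesh_floor (N k) x) \<longlonglongrightarrow> x"
proof -
  have "(\<lambda>k. real CARD('n) * (1 / real (N k))) \<longlonglongrightarrow> 0"
    using tendsto_mult_right_zero[OF mesh_lim] by simp
  then have "(\<lambda>k. mesh_floor (N k) x - x) \<longlonglongrightarrow> 0"
    by (rule Lim_null_comparison[rotated]) (use norm_mesh_floor_diff[OF N, where x = x] in simp)
  then show ?thesis
    by (simp add: Lim_null[symmetric])
qed

lemma almost_lipschitz:
  obtains K where "K \<ge> 0"
    "\<And>k y z. y \<in> mesh_lattice (N k) \<Longrightarrow> z \<in> mesh_lattice (N k) \<Longrightarrow>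
      u k y - u k z \<le> K * (norm (y - z) + \<tau> k)"
proof -
  obtain K where K: "K \<ge> 0"
    "\<And>N \<tau> c u y z. N \<ge> 1 \<Longrightarrow> \<tau> > 0 \<Longrightarrow> 1 / real N \<le> \<tau> \<Longrightarrow> discrete_solution L N \<tau> c u \<Longrightarrow>
      y \<in> mesh_lattice N \<Longrightarrow> z \<in> mesh_lattice N \<Longrightarrow> u y - u z \<le> K * (norm (y - z) + \<tau>)"
    using discrete_solution_almost_lipschitz by blast
  show ?thesis
    by (rule that[OF K(1)]) (rule K(2)[OF N \<tau> N\<tau> solution])
qed

lemma Bseq_sample: "Bseq (sample x)"
proof -
  obtain K where K: "K \<ge> 0"
    "\<And>k y z. y \<in> mesh_lattice (N k) \<Longrightarrow> z \<in> mesh_lattice (N k) \<Longrightarrow>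
      u k y - u k z \<le> K * (norm (y - z) + \<tau> k)"
    using almost_lipschitz by blast
  have "norm (sample x k) \<le> norm (K * (norm (mesh_floor (N k) x) + \<tau> k))" for k
  proof -
    have "(0::real^'n) \<in> mesh_lattice (N k)"
      by (simp add: mesh_lattice_def)
    then have "\<bar>sample x k\<bar> \<le> K * (norm (mesh_floor (N k) x) + \<tau> k)"
      using K(2)[OF floor_in[of k x], of 0] K(2)[OF _ floor_in[of k x], of 0] normalized[of k]
      unfolding sample_def by simp
    then show ?thesis by simp
  qed
  moreover have "(\<lambda>k. K * (norm (mesh_floor (N k) x) + \<tau> k)) \<longlonglongrightarrow> K * (norm x + 0)"
    by (intro tendsto_intros floor_lim \<tau>_lim)
  then have "Bseq (\<lambda>k. K * (norm (mesh_floor (N k) x) + \<tau> k))"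
    by (intro convergent_imp_Bseq convergentI)
  then obtain B where "\<And>k. norm (K * (norm (mesh_floor (N k) x) + \<tau> k)) \<le> B"
    by (auto simp: Bseq_def)
  ultimately show ?thesis
    by (meson BseqI' order.trans)
qed

lemma periodic_limit_solution: "periodic limit_solution"
proof -
  have "sample (x + l) = sample x" if "l \<in> int_lattice" for x l
  proof
    fix k
    have "periodic (u k)"
      using solution[of k] by (simp add: discrete_solution_def)
    then show "sample (x + l) k = sample x k"
      using that by (simp add: sample_def mesh_floor_add_int[OF N] periodicD)
  qed
  then show ?thesis
    by (simp add: periodic_def limit_solution_def)
qed

lemma lipschitz_limit_solution: "\<exists>K\<ge>0. \<forall>x y. limit_solution y - limit_solution x \<le> K * norm (y - x)"
proof -
  obtain K where K: "K \<ge> 0"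
    "\<And>k y z. y \<in> mesh_lattice (N k) \<Longrightarrow> z \<in> mesh_lattice (N k) \<Longrightarrow>
      u k y - u k z \<le> K * (norm (y - z) + \<tau> k)"
    using almost_lipschitz by blast
  have "limit_solution y - limit_solution x \<le> K * norm (y - x)" for x y
  proof -
    have "(\<lambda>k. K * (norm (mesh_floor (N k) y - mesh_floor (N k) x) + \<tau> k)) \<longlonglongrightarrow> K * (norm (y - x) + 0)"
      by (intro tendsto_intros floor_lim \<tau>_lim)
    moreover have "sample y k \<le> sample x k + K * (norm (mesh_floor (N k) y - mesh_floor (N k) x) + \<tau> k)" for k
      using K(2)[OF floor_in[of k y] floor_in[of k x]] by (simp add: sample_def algebra_simps)
    ultimately have "limit_solution y \<le> limit_solution x + K * (norm (y - x) + 0)"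
      unfolding limit_solution_def
      by (intro real_liminf_mono[OF Bseq_sample Bseq_sample]) auto
    then show ?thesis by simp
  qed
  then show ?thesis
    using K(1) by blast
qed

text \<open>The elapsed time is never shorter than \<open>t\<close>, so a displacement allowed in
  time \<open>t\<close> stays allowed; the excess is at most one time step.\<close>

definition steps :: "real \<Rightarrow> nat \<Rightarrow> nat" where
  "steps t k = nat \<lfloor>t / \<tau> k\<rfloor> + 1"

lemma steps_pos: "steps t k \<ge> 1"
  by (simp add: steps_def)

lemma steps_bounds:
  assumes "t > 0"
  shows "t \<le> real (steps t k) * \<tau> k" "real (steps t k) * \<tau> k \<le> t + \<tau> k"
proof -
  have "0 \<le> t / \<tau> k"
    using assms \<tau>[of k] by simp
  then have "t / \<tau> k \<le> real (steps t k)" "real (steps t k) \<le> t / \<tau> k + 1"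
    unfolding steps_def by linarith+
  then show "t \<le> real (steps t k) * \<tau> k" "real (steps t k) * \<tau> k \<le> t + \<tau> k"
    using \<tau>[of k] by (simp_all add: field_simps)
qed

lemma steps_lim:
  assumes "t > 0"
  shows "(\<lambda>k. real (steps t k) * \<tau> k) \<longlonglongrightarrow> t"
proof -
  have "(\<lambda>k. t + \<tau> k) \<longlonglongrightarrow> t"
    using tendsto_add[OF tendsto_const \<tau>_lim] by simp
  then show ?thesis
    by (rule tendsto_sandwich[OF _ _ tendsto_const, rotated -1]) (use steps_bounds[OF assms] in auto)
qed

text \<open>Rounding the end points may push the displacement beyond \<open>R * t\<close>. The fine
  estimate is therefore taken with speed bound \<open>\<bar>R\<bar> + 1\<close>, whose slack
  eventually absorbs the rounding.\<close>

lemma subaction_limit_solution: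
  "\<exists>C\<ge>0. \<forall>t x y. t > 0 \<longrightarrow> norm (y - x) \<le> R * t \<longrightarrow>
    limit_solution y - limit_solution x \<le> t * (L x ((y - x) /\<^sub>R t) + C * t - c_lim)"
proof -
  obtain C where C: "C \<ge> 0"
    "\<And>N \<tau> c u n x y. N \<ge> 1 \<Longrightarrow> \<tau> > 0 \<Longrightarrow> 1 / real N \<le> \<tau> \<Longrightarrow> discrete_solution L N \<tau> c u \<Longrightarrow>
      n \<ge> 1 \<Longrightarrow> x \<in> mesh_lattice N \<Longrightarrow> y \<in> mesh_lattice N \<Longrightarrow> norm (y - x) \<le> (\<bar>R\<bar> + 1) * (real n * \<tau>) \<Longrightarrow>
      u y - u x \<le> real n * \<tau> *
        (L x ((y - x) /\<^sub>R (real n * \<tau>)) + C * (real n * \<tau> + 1 / real N / \<tau>) - c)"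
    using discrete_solution_subaction[of "\<bar>R\<bar> + 1"] by blast
  have "limit_solution y - limit_solution x \<le> t * (L x ((y - x) /\<^sub>R t) + C * t - c_lim)"
    if t: "t > 0" and R: "norm (y - x) \<le> R * t" for t x y
  proof -
    let ?x = "\<lambda>k. mesh_floor (N k) x" and ?y = "\<lambda>k. mesh_floor (N k) y"
    let ?t = "\<lambda>k. real (steps t k) * \<tau> k"
    define a where "a k = ?t k * (L (?x k) ((?y k - ?x k) /\<^sub>R ?t k)
      + C * (?t k + 1 / real (N k) / \<tau> k) - c k)" for k
    have "a \<longlonglongrightarrow> t * (L x ((y - x) /\<^sub>R t) + C * (t + 0) - c_lim)"
      unfolding a_def using t
      by (intro tendsto_intros L_tendsto floor_lim steps_lim ratio_lim c_lim) auto
    moreover have "\<forall>\<^sub>F k in sequentially. sample y k \<le> sample x k + a k"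
    proof -
      have "(\<lambda>k. norm (?y k - ?x k)) \<longlonglongrightarrow> norm (y - x)"
        by (intro tendsto_intros floor_lim)
      moreover have "norm (y - x) < (\<bar>R\<bar> + 1) * t"
      proof -
        have "R * t \<le> \<bar>R\<bar> * t"
          using t by (intro mult_right_mono) auto
        then show ?thesis
          using R t unfolding distrib_right by linarith
      qed
      ultimately have "\<forall>\<^sub>F k in sequentially. norm (?y k - ?x k) < (\<bar>R\<bar> + 1) * t"
        by (rule order_tendstoD)
      then show ?thesis
      proof (rule eventually_mono)
        fix k assume "norm (?y k - ?x k) < (\<bar>R\<bar> + 1) * t"
        moreover have "(\<bar>R\<bar> + 1) * t \<le> (\<bar>R\<bar> + 1) * ?t k"
          using steps_bounds(1)[OF t] by (intro mult_left_mono) auto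
        ultimately show "sample y k \<le> sample x k + a k"
          using C(2)[OF N \<tau> N\<tau> solution steps_pos[of t k] floor_in[of k x] floor_in[of k y]]
          by (simp add: sample_def a_def)
      qed
    qed
    ultimately have "limit_solution y \<le> limit_solution x + t * (L x ((y - x) /\<^sub>R t) + C * (t + 0) - c_lim)"
      unfolding limit_solution_def by (intro real_liminf_mono[OF Bseq_sample Bseq_sample])
    then show ?thesis by simp
  qed
  then show ?thesis
    using C(1) by blast
qed

text \<open>A subsequence is chosen twice: to realize the lower limit at \<open>y\<close>, then to
  make the predecessors converge. At their limit \<open>x\<close> only an upper bound is wanted, for
  which this subsequence suffices.\<close>

lemma calibrated_limit_solution:
  "\<exists>R\<ge>0. \<exists>C\<ge>0. \<forall>t y. t > 0 \<longrightarrow> (\<exists>x. norm (y - x) \<le> R * t \<and>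
    limit_solution x + t * L x ((y - x) /\<^sub>R t) \<le> limit_solution y + t * (c_lim + C * t))"
proof -
  obtain K where K: "K \<ge> 0"
    "\<And>k y z. y \<in> mesh_lattice (N k) \<Longrightarrow> z \<in> mesh_lattice (N k) \<Longrightarrow>
      u k y - u k z \<le> K * (norm (y - z) + \<tau> k)"
    using almost_lipschitz by blast
  obtain R C where RC: "R \<ge> 0" "C \<ge> 0"
    "\<And>N \<tau> c u n y. N \<ge> 1 \<Longrightarrow> \<tau> > 0 \<Longrightarrow> 1 / real N \<le> \<tau> \<Longrightarrow> discrete_solution L N \<tau> c u \<Longrightarrow>
      n \<ge> 1 \<Longrightarrow> y \<in> mesh_lattice N \<Longrightarrow>
      \<exists>x\<in>mesh_lattice N. norm (y - x) \<le> R * (real n * \<tau>) \<and>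
        u x + real n * \<tau> * L x ((y - x) /\<^sub>R (real n * \<tau>)) \<le> u y + real n * \<tau> * (c + C * (real n * \<tau>))"
    using discrete_solution_calibrated by blast
  have "\<exists>x. norm (y - x) \<le> R * t \<and>
      limit_solution x + t * L x ((y - x) /\<^sub>R t) \<le> limit_solution y + t * (c_lim + C * t)"
    if t: "t > 0" for t y
  proof -
    let ?y = "\<lambda>k. mesh_floor (N k) y" and ?t = "\<lambda>k. real (steps t k) * \<tau> k"
    have ex: "\<forall>k. \<exists>x. x \<in> mesh_lattice (N k) \<and> norm (?y k - x) \<le> R * ?t k \<and>
        u k x + ?t k * L x ((?y k - x) /\<^sub>R ?t k) \<le> u k (?y k) + ?t k * (c k + C * ?t k)"
      by (rule allI, rule RC(3)[OF N \<tau> N\<tau> solution steps_pos floor_in, unfolded Bex_def])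
    obtain p where "\<forall>k. p k \<in> mesh_lattice (N k) \<and> norm (?y k - p k) \<le> R * ?t k \<and>
        u k (p k) + ?t k * L (p k) ((?y k - p k) /\<^sub>R ?t k) \<le> u k (?y k) + ?t k * (c k + C * ?t k)"
      using choice[OF ex] by blast
    then have p: "\<And>k. p k \<in> mesh_lattice (N k)" "\<And>k. norm (?y k - p k) \<le> R * ?t k"
      "\<And>k. u k (p k) + ?t k * L (p k) ((?y k - p k) /\<^sub>R ?t k) \<le> u k (?y k) + ?t k * (c k + C * ?t k)"
      by blast+
    obtain r where r: "strict_mono r" "(\<lambda>k. sample y (r k)) \<longlonglongrightarrow> limit_solution y"
      unfolding limit_solution_def using real_liminf_subseq[OF Bseq_sample] .
    have "bounded (range (\<lambda>k. p (r k)))"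
    proof -
      have "(\<lambda>k. norm (?y k) + R * ?t k) \<longlonglongrightarrow> norm y + R * t"
        by (intro tendsto_intros floor_lim steps_lim t)
      then have "Bseq (\<lambda>k. norm (?y k) + R * ?t k)"
        by (intro convergent_imp_Bseq convergentI)
      then obtain B where B: "\<And>k. \<bar>norm (?y k) + R * ?t k\<bar> \<le> B"
        by (auto simp: Bseq_def)
      have "norm (p k) \<le> B" for k
        using B[of k] p(2)[of k] norm_triangle_sub[of "p k" "?y k"] by (simp add: norm_minus_commute)
      then show ?thesis
        by (auto simp: bounded_iff)
    qed
    then obtain x s where s: "strict_mono s" "((\<lambda>k. p (r k)) \<circ> s) \<longlonglongrightarrow> x"
      using bounded_imp_convergent_subsequence by blast
    define q where "q = r \<circ> s"
    have q: "strict_mono q"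
      unfolding q_def by (rule strict_mono_o[OF r(1) s(1)])
    have px: "(\<lambda>k. p (q k)) \<longlonglongrightarrow> x"
      using s(2) by (simp add: q_def o_def)
    have sy: "(\<lambda>k. sample y (q k)) \<longlonglongrightarrow> limit_solution y"
      using LIMSEQ_subseq_LIMSEQ[OF r(2) s(1)] by (simp add: q_def o_def)
    note sub = LIMSEQ_subseq_LIMSEQ[OF _ q, unfolded o_def]
    note lims = sub[OF floor_lim] sub[OF steps_lim[OF t]] sub[OF c_lim] sub[OF \<tau>_lim] px sy
    have "norm (y - x) \<le> R * t"
    proof (rule LIMSEQ_le)
      show "(\<lambda>k. norm (?y (q k) - p (q k))) \<longlonglongrightarrow> norm (y - x)"
        by (intro tendsto_intros lims)
      show "(\<lambda>k. R * ?t (q k)) \<longlonglongrightarrow> R * t"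
        by (intro tendsto_intros lims)
    qed (use p(2) in auto)
    moreover have "limit_solution x + t * L x ((y - x) /\<^sub>R t) \<le> limit_solution y + t * (c_lim + C * t)"
    proof -
      \<comment> \<open>The last term pays for moving from the predecessor \<open>p k\<close> to the
        mesh point below \<open>x\<close>. Along \<open>q\<close> both converge to \<open>x\<close>,
        so it vanishes.\<close>
      define g where "g k = sample y k + ?t k * (c k + C * ?t k) - ?t k * L (p k) ((?y k - p k) /\<^sub>R ?t k)
        + K * (norm (mesh_floor (N k) x - p k) + \<tau> k)" for k
      have "sample x k \<le> g k" for k
        using K(2)[OF floor_in[of k x] p(1)] p(3)[of k] by (simp add: sample_def g_def)
      then have "\<forall>\<^sub>F k in sequentially. sample x (q k) \<le> g (q k)"
        by simp
      moreover have "(\<lambda>k. g (q k)) \<longlonglongrightarrow> limit_solution y + t * (c_lim + C * t)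
          - t * L x ((y - x) /\<^sub>R t) + K * (norm (x - x) + 0)"
        unfolding g_def using t by (intro tendsto_intros L_tendsto lims) auto
      ultimately have "real_liminf (sample x) \<le> limit_solution y + t * (c_lim + C * t)
          - t * L x ((y - x) /\<^sub>R t) + K * (norm (x - x) + 0)"
        by (rule real_liminf_le_subseq[OF Bseq_sample q])
      then show ?thesis
        by (simp add: limit_solution_def)
    qed
    ultimately show ?thesis by blast
  qed
  then show ?thesis
    using RC(1,2) by blast
qed

lemma weak_kam_limit_solution: "weak_kam c_lim limit_solution"
  unfolding weak_kam_def
  by (intro conjI allI periodic_limit_solution lipschitz_limit_solution subaction_limit_solution
    calibrated_limit_solution)

end

lemma (in tonelli_lagrangian) weak_kam_exists:
  obtains c u where "weak_kam c u"
proof -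
  \<comment> \<open>With a mesh size equal to the square of the time step, the ratio
    \<open>h/\<tau>\<close> is \<open>\<tau>\<close> itself and tends to 0 with it.\<close>
  define \<tau> where "\<tau> k = 1 / real (Suc k)" for k
  define N where "N k = Suc k * Suc k" for k
  have N: "N k \<ge> 1" and \<tau>: "\<tau> k > 0" for k
    by (auto simp: N_def \<tau>_def)
  have ratio: "1 / real (N k) / \<tau> k = \<tau> k" for k
    unfolding N_def \<tau>_def of_nat_mult by (simp del: of_nat_Suc)
  have N\<tau>: "1 / real (N k) \<le> \<tau> k" for k
  proof -
    have "1 / real (N k) / \<tau> k \<le> 1"
      unfolding ratio by (simp add: \<tau>_def)
    then show ?thesis
      unfolding pos_divide_le_eq[OF \<tau>] by simp
  qed
  define c where "c k = discrete_critical_value L (N k) (\<tau> k)" for k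
  have "\<exists>u. discrete_solution L (N k) (\<tau> k) (c k) u" for k
    unfolding c_def by (rule discrete_solution_discrete_critical_value[OF N \<tau>]) blast
  then obtain v where v: "\<And>k. discrete_solution L (N k) (\<tau> k) (c k) (v k)"
    by metis
  define u where "u k x = v k x - v k 0" for k x
  have u: "discrete_solution L (N k) (\<tau> k) (c k) (u k)" for k
    using v[of k] by (simp add: discrete_solution_def u_def periodic_def diff_add_eq)
  obtain C where "C \<ge> 0"
    and C: "\<And>N \<tau> c u. N \<ge> 1 \<Longrightarrow> \<tau> > 0 \<Longrightarrow> discrete_solution L N \<tau> c u \<Longrightarrow> \<bar>c\<bar> \<le> C"
    using discrete_value_bounded by blast
  have "\<bar>c k\<bar> \<le> C" for k
    by (rule C[OF N \<tau> u])
  then have "bounded (range c)"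
    by (auto simp: bounded_iff)
  then obtain c_lim r where r: "strict_mono r" "(c \<circ> r) \<longlonglongrightarrow> c_lim"
    using bounded_imp_convergent_subsequence by blast
  have "\<tau> \<longlonglongrightarrow> 0"
    unfolding \<tau>_def by (rule LIMSEQ_Suc[OF lim_inverse_n'])
  then have "(\<tau> \<circ> r) \<longlonglongrightarrow> 0"
    by (rule LIMSEQ_subseq_LIMSEQ[OF _ r(1)])
  moreover from this have "(\<lambda>k. 1 / real ((N \<circ> r) k) / (\<tau> \<circ> r) k) \<longlonglongrightarrow> 0"
    by (simp only: o_def ratio)
  moreover have "(u \<circ> r) k 0 = 0" for k
    by (simp add: u_def)
  ultimately interpret vanishing_mesh L "N \<circ> r" "\<tau> \<circ> r" "c \<circ> r" "u \<circ> r" c_lim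
    by unfold_locales (use N \<tau> N\<tau> u r(2) in \<open>simp_all only: o_apply\<close>)
  show ?thesis
    using that weak_kam_limit_solution by blast
qed

subsection \<open>The rate of convergence\<close>

text \<open>\<open>u\<close> is a barrier from both sides. As a subsolution it loses only
  \<open>O(\<tau>)\<close>, its inequality holding between arbitrary points of space. As a
  supersolution its predecessor may lie off the lattice: rounding it changes \<open>u\<close> by
  \<open>O(h)\<close>, that is \<open>O(h/\<tau>)\<close> per unit time, and also shifts the
  arguments of \<open>L\<close>.\<close>

lemma (in tonelli_lagrangian) discrete_critical_value_near_weak_kam:
  assumes "weak_kam c u"
  obtains C where "C > 0"
    "\<And>N \<tau>. N \<ge> 1 \<Longrightarrow> \<tau> > 0 \<Longrightarrow> 1 / real N \<le> \<tau> \<Longrightarrow>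
      \<bar>discrete_critical_value L N \<tau> - c\<bar> \<le> C * (\<tau> + 1 / real N / \<tau>)"
proof -
  define d where "d = real CARD('n)"
  have d: "d \<ge> 0" by (simp add: d_def)
  have per: "periodic u"
    using assms by (simp add: weak_kam_def)
  obtain K where K: "K \<ge> 0" "\<And>x y. u y - u x \<le> K * norm (y - x)"
    using assms by (auto simp: weak_kam_def)
  obtain A where A: "\<And>x v. (K + 1) * norm v - A \<le> L x v"
    using L_superlinear[of "K + 1"] by blast
  \<comment> \<open>Beyond distance \<open>R * \<tau>\<close> the inequality is automatic: the
    surplus slope 1 over the Lipschitz constant \<open>K\<close> pays for \<open>A\<close> and
    \<open>c\<close>.\<close>
  define R where "R = \<bar>A\<bar> + \<bar>c\<bar>"
  have "\<exists>C\<ge>0. \<forall>t x y. t > 0 \<longrightarrow> norm (y - x) \<le> R * t \<longrightarrow>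
      u y - u x \<le> t * (L x ((y - x) /\<^sub>R t) + C * t - c)"
    using assms unfolding weak_kam_def by blast
  then obtain C1 where C1: "C1 \<ge> 0" "\<And>t x y. t > 0 \<Longrightarrow> norm (y - x) \<le> R * t \<Longrightarrow>
      u y - u x \<le> t * (L x ((y - x) /\<^sub>R t) + C1 * t - c)"
    by blast
  have "\<exists>R\<ge>0. \<exists>C\<ge>0. \<forall>t y. t > 0 \<longrightarrow>
      (\<exists>x. norm (y - x) \<le> R * t \<and> u x + t * L x ((y - x) /\<^sub>R t) \<le> u y + t * (c + C * t))"
    using assms unfolding weak_kam_def by blast
  then obtain S C2 where S: "S \<ge> 0" and C2: "C2 \<ge> 0" "\<And>t y. t > 0 \<Longrightarrow>
      \<exists>x. norm (y - x) \<le> S * t \<and> u x + t * L x ((y - x) /\<^sub>R t) \<le> u y + t * (c + C2 * t)"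
    by blast
  obtain C3 where C3: "C3 \<ge> 0" "\<And>x y v w. norm v \<le> S + d \<Longrightarrow> norm w \<le> S + d \<Longrightarrow>
      \<bar>L x v - L y w\<bar> \<le> C3 * (norm (x - y) + norm (v - w))"
    using L_lipschitz[of "S + d"] by blast
  define C where "C = C1 + C2 + K * d + C3 * d + 1"
  have "\<bar>discrete_critical_value L N \<tau> - c\<bar> \<le> C * (\<tau> + 1 / real N / \<tau>)"
    if *: "N \<ge> 1" "\<tau> > 0" "1 / real N \<le> \<tau>" for N \<tau>
  proof -
    define h where "h = 1 / real N"
    have h: "h \<ge> 0" "h \<le> \<tau>"
      using * by (auto simp: h_def)
    obtain w where w: "discrete_solution L N \<tau> (discrete_critical_value L N \<tau>) w"
      using discrete_solution_discrete_critical_value[OF *(1,2)] .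
    have low: "c - C1 * \<tau> \<le> discrete_critical_value L N \<tau>"
    proof (rule subsolution_le_discrete_value[OF *(1,2) w per])
      fix y z :: "real^'n"
      show "u y + \<tau> * (c - C1 * \<tau>) \<le> u z + \<tau> * L z ((y - z) /\<^sub>R \<tau>)"
      proof (cases "norm (y - z) \<le> R * \<tau>")
        case True
        then show ?thesis
          using C1(2)[OF *(2) True] by (simp add: algebra_simps)
      next
        case False
        have "\<tau> * ((K + 1) * norm ((y - z) /\<^sub>R \<tau>) - A) \<le> \<tau> * L z ((y - z) /\<^sub>R \<tau>)"
          using A[of "(y - z) /\<^sub>R \<tau>" z] *(2) by (intro mult_left_mono) auto
        moreover have "\<tau> * ((K + 1) * norm ((y - z) /\<^sub>R \<tau>) - A) = K * norm (y - z) + norm (y - z) - \<tau> * A"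
        proof -
          have "\<tau> * norm ((y - z) /\<^sub>R \<tau>) = norm (y - z)"
            using *(2) by simp
          then show ?thesis
            by (simp only: right_diff_distrib distrib_right mult.left_commute[of \<tau>] distrib_left mult_1)
        qed
        moreover have "\<tau> * A \<le> \<tau> * \<bar>A\<bar>" "\<tau> * c \<le> \<tau> * \<bar>c\<bar>"
          using *(2) by (auto intro!: mult_left_mono)
        moreover have "R * \<tau> = \<tau> * \<bar>A\<bar> + \<tau> * \<bar>c\<bar>"
          by (simp add: R_def algebra_simps)
        moreover have "\<tau> * (C1 * \<tau>) \<ge> 0"
          using C1(1) *(2) by simp
        ultimately show ?thesis
          using False K(2)[of y z] unfolding right_diff_distrib by linarith
      qed
    qed
    have up: "discrete_critical_value L N \<tau> \<le> c + (C2 * \<tau> + K * d * (h / \<tau>) + C3 * d * (\<tau> + h / \<tau>))"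
    proof (rule discrete_value_le_supersolution[OF *(1,2) w per])
      fix y :: "real^'n"
      obtain x where x: "norm (y - x) \<le> S * \<tau>"
        "u x + \<tau> * L x ((y - x) /\<^sub>R \<tau>) \<le> u y + \<tau> * (c + C2 * \<tau>)"
        using C2(2)[OF *(2)] by blast
      define z where "z = mesh_floor N x"
      have zx: "norm (z - x) \<le> d * h"
        using norm_mesh_floor_diff[OF *(1), of x] by (simp add: z_def d_def h_def)
      have v: "norm ((y - x) /\<^sub>R \<tau>) \<le> S"
        using x(1) *(2) by (subst norm_divideR_le_iff)
      have vv: "norm ((y - z) /\<^sub>R \<tau> - (y - x) /\<^sub>R \<tau>) \<le> d * (h / \<tau>)"
      proof -
        have "(y - z) /\<^sub>R \<tau> - (y - x) /\<^sub>R \<tau> = (x - z) /\<^sub>R \<tau>"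
          by (simp flip: scaleR_diff_right)
        moreover have "norm ((x - z) /\<^sub>R \<tau>) \<le> d * (h / \<tau>)"
          using zx *(2) by (subst norm_divideR_le_iff) (simp_all add: norm_minus_commute)
        ultimately show ?thesis by simp
      qed
      also have "\<dots> \<le> d * 1"
        using h *(2) d by (intro mult_left_mono) auto
      finally have "norm ((y - z) /\<^sub>R \<tau>) \<le> S + d"
        using v norm_triangle_sub[of "(y - z) /\<^sub>R \<tau>" "(y - x) /\<^sub>R \<tau>"] by linarith
      then have "L z ((y - z) /\<^sub>R \<tau>) - L x ((y - x) /\<^sub>R \<tau>)
          \<le> C3 * (norm (z - x) + norm ((y - z) /\<^sub>R \<tau> - (y - x) /\<^sub>R \<tau>))"
        using C3(2)[of "(y - z) /\<^sub>R \<tau>" "(y - x) /\<^sub>R \<tau>" z x] v d by linarith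
      also have "\<dots> \<le> C3 * (d * \<tau> + d * (h / \<tau>))"
        using zx vv mult_left_mono[OF h(2) d] C3(1) by (intro mult_left_mono add_mono) auto
      finally have "\<tau> * L z ((y - z) /\<^sub>R \<tau>) \<le> \<tau> * (L x ((y - x) /\<^sub>R \<tau>) + C3 * (d * \<tau> + d * (h / \<tau>)))"
        using *(2) by (intro mult_left_mono) auto
      moreover have "u z \<le> u x + K * (d * h)"
        using K(2)[where x = x and y = z] mult_left_mono[OF zx K(1)] by linarith
      moreover have "K * (d * h) = \<tau> * (K * d * (h / \<tau>))"
        using *(2) by simp
      ultimately have "u z + \<tau> * L z ((y - z) /\<^sub>R \<tau>)
          \<le> u y + \<tau> * (c + (C2 * \<tau> + K * d * (h / \<tau>) + C3 * d * (\<tau> + h / \<tau>)))"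
        using x(2) by (simp only: distrib_left mult.assoc)
      then show "\<exists>z\<in>mesh_lattice N. u z + \<tau> * L z ((y - z) /\<^sub>R \<tau>)
          \<le> u y + \<tau> * (c + (C2 * \<tau> + K * d * (h / \<tau>) + C3 * d * (\<tau> + h / \<tau>)))"
        using mesh_floor_in[OF *(1)] by (auto simp: z_def)
    qed
    define q where "q = h / \<tau>"
    have "q \<ge> 0"
      using h *(2) by (simp add: q_def)
    moreover have "C1 \<le> C" "C2 + C3 * d \<le> C" "K * d + C3 * d \<le> C"
      using C1(1) C2(1) C3(1) K(1) d by (auto simp: C_def)
    ultimately have "C1 * \<tau> \<le> C * \<tau>" "0 \<le> C * q"
        "(C2 + C3 * d) * \<tau> \<le> C * \<tau>" "(K * d + C3 * d) * q \<le> C * q"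
      using *(2) C1(1) by (auto intro!: mult_right_mono mult_nonneg_nonneg)
    then show ?thesis
      using low up unfolding h_def[symmetric] q_def[symmetric] abs_le_iff distrib_left distrib_right by linarith
  qed
  then show ?thesis
    using that[of C] C1(1) C2(1) C3(1) K(1) d by (simp add: C_def add_nonneg_pos)
qed

subsection \<open>The limit is a viscosity solution\<close>

lemma GDERIV_expansion:
  assumes "GDERIV \<phi> x :> D" "e > 0"
  obtains \<delta> where "\<delta> > 0"
    "\<And>h. norm h < \<delta> \<Longrightarrow> \<bar>\<phi> (x - h) - \<phi> x + D \<bullet> h\<bar> \<le> e * norm h"
proof -
  obtain \<delta> where \<delta>: "\<delta> > 0" "\<And>y. norm (y - x) < \<delta> \<Longrightarrow> norm (\<phi> y - \<phi> x - (y - x) \<bullet> D) \<le> e * norm (y - x)"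
    using assms unfolding gderiv_def has_derivative_at_alt by blast
  show ?thesis
  proof (rule that[OF \<delta>(1)])
    fix h :: 'a assume "norm h < \<delta>"
    then show "\<bar>\<phi> (x - h) - \<phi> x + D \<bullet> h\<bar> \<le> e * norm h"
      using \<delta>(2)[of "x - h"] by (simp add: inner_commute)
  qed
qed

lemma le_of_forall_le_add_mult:
  fixes a b M :: real
  assumes "M \<ge> 0" "\<And>e. e > 0 \<Longrightarrow> a \<le> b + e * M"
  shows "a \<le> b"
proof (rule field_le_epsilon)
  fix e :: real assume "e > 0"
  then have "a \<le> b + e / (M + 1) * M"
    using assms(1) by (intro assms(2)) simp
  also have "e / (M + 1) * M \<le> e"
    using \<open>e > 0\<close> assms(1) by (simp add: field_simps)
  finally show "a \<le> b + e" by simp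
qed

text \<open>Together the two assumptions say that \<open>H\<close> is the convex conjugate of
  \<open>L\<close> in the velocity, with attained supremum.\<close>

locale tonelli_pair = tonelli_lagrangian L for L :: "real^'n \<Rightarrow> real^'n \<Rightarrow> real" +
  fixes H :: "real^'n \<Rightarrow> real^'n \<Rightarrow> real"
  assumes fenchel: "p \<bullet> v - H x p \<le> L x v"
    and fenchel_attained: "\<exists>v. L x v \<le> p \<bullet> v - H x p"
begin

text \<open>Step back from \<open>x\<close> along a velocity \<open>v\<close> conjugate to
  \<open>D x\<close>. Touching from above transfers the one-step inequality from \<open>u\<close> to
  \<open>\<phi>\<close>; division by \<open>t\<close> gives
  \<open>D x \<bullet> v - L x v \<le> - c\<close> up to \<open>O(e)\<close>, and conjugacy puts
  \<open>H x (D x)\<close> below the left side.\<close>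

lemma weak_kam_viscosity_subsolution:
  assumes "weak_kam c u"
  shows "viscosity_subsolution H (- c) u"
  unfolding viscosity_subsolution_def
proof safe
  fix \<phi> D x
  assume \<phi>: "C1_with_gradient \<phi> D" and max: "\<forall>\<^sub>F y in nhds x. u y - \<phi> y \<le> u x - \<phi> x"
  obtain v where v: "L x v \<le> D x \<bullet> v - H x (D x)"
    using fenchel_attained by blast
  have "\<exists>C\<ge>0. \<forall>t x y. t > 0 \<longrightarrow> norm (y - x) \<le> norm v * t \<longrightarrow>
      u y - u x \<le> t * (L x ((y - x) /\<^sub>R t) + C * t - c)"
    using assms unfolding weak_kam_def by blast
  then obtain C where C: "C \<ge> 0" "\<And>t x y. t > 0 \<Longrightarrow> norm (y - x) \<le> norm v * t \<Longrightarrow>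
      u y - u x \<le> t * (L x ((y - x) /\<^sub>R t) + C * t - c)"
    by blast
  obtain B where B: "B \<ge> 0" "\<And>x y v' w. norm v' \<le> norm v \<Longrightarrow> norm w \<le> norm v \<Longrightarrow>
      \<bar>L x v' - L y w\<bar> \<le> B * (norm (x - y) + norm (v' - w))"
    using L_lipschitz[of "norm v"] by blast
  obtain r where r: "r > 0" "\<And>y. dist y x < r \<Longrightarrow> u y - \<phi> y \<le> u x - \<phi> x"
    using max unfolding eventually_nhds_metric by blast
  have "D x \<bullet> v \<le> L x v - c + e * (norm v + B * norm v + C)" if e: "e > 0" for e
  proof -
    have grad: "GDERIV \<phi> x :> D x"
      using \<phi> by (simp add: C1_with_gradient_def)
    obtain \<delta> where \<delta>: "\<delta> > 0" "\<And>h. norm h < \<delta> \<Longrightarrow> \<bar>\<phi> (x - h) - \<phi> x + D x \<bullet> h\<bar> \<le> e * norm h"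
      using GDERIV_expansion[OF grad e] by blast
    define t where "t = min e (min \<delta> r / (norm v + 1))"
    have nv: "norm v + 1 > 0"
      using norm_ge_zero[of v] by linarith
    have t: "t > 0" "t \<le> e"
      using e \<delta>(1) r(1) nv by (auto simp: t_def)
    have "t * (norm v + 1) \<le> min \<delta> r"
      using nv unfolding pos_le_divide_eq[symmetric, OF nv] by (simp add: t_def)
    then have small: "t * norm v < \<delta>" "t * norm v < r"
      using t(1) by (auto simp: distrib_left)
    define z where "z = x - t *\<^sub>R v"
    have nz: "norm (x - z) = t * norm v"
      using t(1) by (simp add: z_def)
    have "u x - u z \<le> t * (L z v + C * t - c)"
      using C(2)[OF t(1), of x z] t(1) by (simp add: z_def)
    moreover have "L z v \<le> L x v + B * (t * norm v)"
      using B(2)[of v v z x] nz by (simp add: norm_minus_commute)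
    then have "t * L z v \<le> t * (L x v + B * (t * norm v))"
      using t(1) by (intro mult_left_mono) auto
    moreover have "u z - \<phi> z \<le> u x - \<phi> x"
      using r(2)[of z] small(2) nz by (simp add: dist_norm norm_minus_commute)
    moreover have "\<bar>\<phi> z - \<phi> x + t * (D x \<bullet> v)\<bar> \<le> e * (t * norm v)"
      using \<delta>(2)[of "t *\<^sub>R v"] small(1) t(1) by (simp add: z_def)
    then have "\<phi> z - \<phi> x + t * (D x \<bullet> v) \<le> e * (t * norm v)"
      by (rule abs_le_D1)
    moreover have "t * (L z v + C * t - c) = t * L z v + t * (C * t - c)" "e * (t * norm v) = t * (e * norm v)"
      by (simp_all add: algebra_simps)
    ultimately have "t * (D x \<bullet> v) \<le> t * (L x v + B * (t * norm v)) + t * (C * t - c) + t * (e * norm v)"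
      by linarith
    then have "t * (D x \<bullet> v) \<le> t * (L x v + B * (t * norm v) + (C * t - c) + e * norm v)"
      by (simp only: distrib_left)
    then have "D x \<bullet> v \<le> L x v + B * (t * norm v) + (C * t - c) + e * norm v"
      using t(1) by (simp only: mult_le_cancel_left_pos)
    also have "\<dots> \<le> L x v + B * (e * norm v) + (C * e - c) + e * norm v"
      using t(2) B(1) C(1) by (intro add_mono mult_left_mono mult_right_mono diff_mono) auto
    finally show ?thesis
      by (simp add: algebra_simps)
  qed
  then have "D x \<bullet> v \<le> L x v - c"
    using B(1) C(1) by - (rule le_of_forall_le_add_mult[of "norm v + B * norm v + C"], simp_all)
  then show "H x (D x) \<le> - c"
    using v by linarith
qed

text \<open>The calibrating velocity varies with \<open>t\<close>, but it stays in a fixed ball and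
  the Fenchel inequality holds for every velocity; so no limit velocity has to be extracted.\<close>

lemma weak_kam_viscosity_supersolution:
  assumes "weak_kam c u"
  shows "viscosity_supersolution H (- c) u"
  unfolding viscosity_supersolution_def
proof safe
  fix \<phi> D x
  assume \<phi>: "C1_with_gradient \<phi> D" and min: "\<forall>\<^sub>F y in nhds x. u y - \<phi> y \<ge> u x - \<phi> x"
  have "\<exists>R\<ge>0. \<exists>C\<ge>0. \<forall>t y. t > 0 \<longrightarrow>
      (\<exists>x. norm (y - x) \<le> R * t \<and> u x + t * L x ((y - x) /\<^sub>R t) \<le> u y + t * (c + C * t))"
    using assms unfolding weak_kam_def by blast
  then obtain R C where R: "R \<ge> 0" and C: "C \<ge> 0" "\<And>t y. t > 0 \<Longrightarrow>
      \<exists>x. norm (y - x) \<le> R * t \<and> u x + t * L x ((y - x) /\<^sub>R t) \<le> u y + t * (c + C * t)"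
    by blast
  obtain B where B: "B \<ge> 0" "\<And>x y v' w. norm v' \<le> R \<Longrightarrow> norm w \<le> R \<Longrightarrow>
      \<bar>L x v' - L y w\<bar> \<le> B * (norm (x - y) + norm (v' - w))"
    using L_lipschitz[of R] by blast
  obtain r where r: "r > 0" "\<And>y. dist y x < r \<Longrightarrow> u y - \<phi> y \<ge> u x - \<phi> x"
    using min unfolding eventually_nhds_metric by blast
  have "- c \<le> H x (D x) + e * (R + B * R + C)" if e: "e > 0" for e
  proof -
    have grad: "GDERIV \<phi> x :> D x"
      using \<phi> by (simp add: C1_with_gradient_def)
    obtain \<delta> where \<delta>: "\<delta> > 0" "\<And>h. norm h < \<delta> \<Longrightarrow> \<bar>\<phi> (x - h) - \<phi> x + D x \<bullet> h\<bar> \<le> e * norm h"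
      using GDERIV_expansion[OF grad e] by blast
    define t where "t = min e (min \<delta> r / (R + 1))"
    have R1: "R + 1 > 0"
      using R by linarith
    have t: "t > 0" "t \<le> e"
      using e \<delta>(1) r(1) R1 by (auto simp: t_def)
    have "t * (R + 1) \<le> min \<delta> r"
      unfolding pos_le_divide_eq[symmetric, OF R1] by (simp add: t_def)
    then have small: "R * t < \<delta>" "R * t < r"
      using t(1) by (auto simp: distrib_left mult.commute)
    obtain z where z: "norm (x - z) \<le> R * t" "u z + t * L z ((x - z) /\<^sub>R t) \<le> u x + t * (c + C * t)"
      using C(2)[OF t(1)] by blast
    define v where "v = (x - z) /\<^sub>R t"
    have v: "norm v \<le> R"
      unfolding v_def using z(1) t(1) by (subst norm_divideR_le_iff)
    have xz: "x - z = t *\<^sub>R v"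
      using t(1) by (simp add: v_def)
    have "L x v \<le> L z v + B * norm (x - z)"
      using B(2)[OF v v, of x z] by simp
    also have "\<dots> \<le> L z v + B * (R * t)"
      using z(1) B(1) by (intro add_left_mono mult_left_mono)
    finally have "t * L x v \<le> t * (L z v + B * (R * t))"
      using t(1) by (intro mult_left_mono) auto
    moreover have "u z + t * L z v \<le> u x + t * (c + C * t)"
      using z(2) by (simp add: v_def)
    moreover have "u x - \<phi> x \<le> u z - \<phi> z"
      using r(2)[of z] small(2) z(1) by (simp add: dist_norm norm_minus_commute)
    moreover have "\<bar>\<phi> z - \<phi> x + t * (D x \<bullet> v)\<bar> \<le> e * (R * t)"
    proof -
      have "\<bar>\<phi> (x - (x - z)) - \<phi> x + D x \<bullet> (x - z)\<bar> \<le> e * norm (x - z)"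
        using z(1) small(1) by (intro \<delta>(2)) linarith
      also have "\<dots> \<le> e * (R * t)"
        using z(1) e by (intro mult_left_mono) auto
      finally have "\<bar>\<phi> z - \<phi> x + D x \<bullet> (x - z)\<bar> \<le> e * (R * t)"
        by simp
      then show ?thesis
        unfolding xz by simp
    qed
    then have "- (\<phi> z - \<phi> x + t * (D x \<bullet> v)) \<le> t * (e * R)"
      using abs_le_D2 by (simp only: mult.left_commute[of t] mult.commute[of t R])
    ultimately have "- (t * c) \<le> t * (D x \<bullet> v) - t * L x v + t * (B * (R * t)) + t * (C * t) + t * (e * R)"
      unfolding distrib_left by linarith
    then have "t * (- c) \<le> t * (D x \<bullet> v - L x v + B * (R * t) + C * t + e * R)"
      by (simp only: distrib_left right_diff_distrib mult_minus_right)
    then have "- c \<le> D x \<bullet> v - L x v + B * (R * t) + C * t + e * R"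
      using t(1) by (simp only: mult_le_cancel_left_pos)
    also have "\<dots> \<le> H x (D x) + B * (R * e) + C * e + e * R"
      using fenchel[of "D x" v x] t(2) B(1) C(1) R e by (intro add_mono mult_left_mono) auto
    finally show ?thesis
      by (simp add: algebra_simps)
  qed
  then show "- c \<le> H x (D x)"
    using B(1) C(1) R by - (rule le_of_forall_le_add_mult[of "R + B * R + C"], simp_all)
qed

lemma weak_kam_viscosity_solution:
  assumes "weak_kam c u"
  shows "viscosity_solution H (- c) u"
proof -
  obtain K where K: "K \<ge> 0" "\<And>x y. u y - u x \<le> K * norm (y - x)"
    using assms by (auto simp: weak_kam_def)
  have "K-lipschitz_on UNIV u"
  proof (rule lipschitz_onI)
    fix x y
    show "dist (u x) (u y) \<le> K * dist x y"
      using K(2)[of x y] K(2)[of y x] by (simp add: dist_norm abs_le_iff norm_minus_commute)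
  qed (rule K(1))
  then have "continuous_on UNIV u"
    by (rule lipschitz_on_continuous_on)
  then show ?thesis
    using assms weak_kam_viscosity_subsolution weak_kam_viscosity_supersolution
    by (simp add: viscosity_solution_def weak_kam_def)
qed

end

subsection \<open>Uniqueness of the critical value\<close>

lemma C1_with_gradient_quadratic:
  "C1_with_gradient (\<lambda>x. a * ((x - y) \<bullet> (x - y))) (\<lambda>x. (2 * a) *\<^sub>R (x - y))"
proof -
  have "GDERIV (\<lambda>x. a * ((x - y) \<bullet> (x - y))) x :> (2 * a) *\<^sub>R (x - y)" for x
    unfolding gderiv_def
    by (auto intro!: derivative_eq_intros simp: inner_commute algebra_simps)
  then show ?thesis
    unfolding C1_with_gradient_def by (auto intro!: continuous_intros)
qed

lemma continuous_periodic_bounded: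
  fixes u :: "real^'n \<Rightarrow> real"
  assumes "continuous_on UNIV u" "periodic u"
  obtains M where "M \<ge> 0" "\<And>x. \<bar>u x\<bar> \<le> M"
proof -
  have "compact (u ` cbox 0 1)"
    using assms(1) by (intro compact_continuous_image compact_cbox) (rule continuous_on_subset, auto)
  then have "bounded (u ` cbox 0 1)"
    by (rule compact_imp_bounded)
  then obtain M where M: "\<And>x. x \<in> cbox 0 1 \<Longrightarrow> \<bar>u x\<bar> \<le> M"
    by (auto simp: bounded_iff)
  have le: "\<bar>u x\<bar> \<le> M" for x
    using M[OF frac_vec_in_cbox[of x]] periodic_frac_vec[OF assms(2), of x] by simp
  then have "M \<ge> 0"
    using abs_ge_zero order.trans by blast
  then show ?thesis
    using that le by blast
qed

text \<open>
  Doubling of variables. Coercivity bounds the slope \<open>(x - y)/e\<close> at the subsolution's point,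
  which makes the two points \<open>O(e)\<close>-close.
\<close>

lemma viscosity_comparison:
  fixes H :: "real^'n \<Rightarrow> real^'n \<Rightarrow> real"
  assumes "superlinear H"
    and lip: "\<And>P. \<exists>C\<ge>0. \<forall>x y p. norm p \<le> P \<longrightarrow> \<bar>H x p - H y p\<bar> \<le> C * norm (x - y)"
    and u: "viscosity_subsolution H a u" "continuous_on UNIV u" "periodic u"
    and v: "viscosity_supersolution H b v" "continuous_on UNIV v" "periodic v"
  shows "b \<le> a"
proof -
  obtain C0 where "\<forall>x p. H x p \<ge> 1 * norm p - C0"
    using assms(1)[unfolded superlinear_def, rule_format, OF zero_less_one] by blast
  then have "1 * norm p - C0 \<le> H x p" for x p
    by blast
  then have C0: "norm p \<le> H x p + C0" for x p
    by (simp add: diff_le_eq)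
  define P where "P = a + C0"
  obtain C where C: "C \<ge> 0" "\<And>x y p. norm p \<le> \<bar>P\<bar> \<Longrightarrow> \<bar>H x p - H y p\<bar> \<le> C * norm (x - y)"
    using lip[of "\<bar>P\<bar>"] by blast
  obtain M1 where M1: "M1 \<ge> 0" "\<And>x. \<bar>u x\<bar> \<le> M1"
    using continuous_periodic_bounded[OF u(2,3)] by blast
  obtain M2 where M2: "M2 \<ge> 0" "\<And>x. \<bar>v x\<bar> \<le> M2"
    using continuous_periodic_bounded[OF v(2,3)] by blast
  have "b \<le> a + e * (C * \<bar>P\<bar>)" if e: "e > 0" for e
  proof -
    \<comment> \<open>Makes the gradient \<open>2 * k * (x - y)\<close> of the penalty equal to
      \<open>(x - y) / e\<close>.\<close>
    define k where "k = 1 / (2 * e)"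
    have k: "k > 0" using e by (simp add: k_def)
    \<comment> \<open>Writing the second point as \<open>x + z\<close> makes \<open>F\<close>
      periodic in \<open>x\<close>, so maximizing over all pairs reduces to a cube times a
      ball.\<close>
    define F where "F = (\<lambda>(x, z). u x - v (x + z) - k * (z \<bullet> z))"
    \<comment> \<open>Outside this radius the penalty beats the oscillation:
      \<open>k * r = 2 * (M1 + M2) + k\<close>, and the added 1 ensures
      \<open>r \<le> r * r\<close>.\<close>
    define r where "r = 2 * (M1 + M2) / k + 1"
    have r: "r \<ge> 1"
      using M1(1) M2(1) k by (simp add: r_def)
    have cont: "continuous_on (cbox 0 1 \<times> cball 0 r) F"
      unfolding F_def case_prod_unfold
      by (intro continuous_intros continuous_on_compose2[OF u(2)] continuous_on_compose2[OF v(2)]) auto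
    have "\<exists>w\<in>cbox 0 1 \<times> cball 0 r. \<forall>y\<in>cbox 0 1 \<times> cball (0::real^'n) r. F y \<le> F w"
    proof (rule continuous_attains_sup[OF _ _ cont])
      have "(0, 0) \<in> cbox (0::real^'n) 1 \<times> cball (0::real^'n) r"
        using r by (auto simp: mem_box_cart)
      then show "cbox 0 1 \<times> cball (0::real^'n) r \<noteq> ({} :: ((real^'n) \<times> (real^'n)) set)"
        by blast
    qed (intro compact_Times compact_cbox compact_cball)
    then obtain w where w: "\<And>y. y \<in> cbox 0 1 \<times> cball 0 r \<Longrightarrow> F y \<le> F w"
      by blast
    obtain x1 z1 where "w = (x1, z1)"
      by (cases w)
    then have max: "F (x, z) \<le> F (x1, z1)" if "x \<in> cbox 0 1" "norm z \<le> r" for x z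
      using w[of "(x, z)"] that by simp
    have glob: "F (x, z) \<le> F (x1, z1)" for x z
    proof (cases "norm z \<le> r")
      case True
      have "F (x, z) = F (frac_vec x, z)"
      proof -
        define l where "l = x - frac_vec x"
        have l: "l \<in> int_lattice"
          unfolding l_def by (rule frac_vec_diff)
        have "v (x + z) = v ((frac_vec x + z) + l)"
          by (simp add: l_def algebra_simps)
        also have "\<dots> = v (frac_vec x + z)"
          by (rule periodicD[OF v(3) l])
        finally show ?thesis
          by (simp add: F_def periodic_frac_vec[OF u(3)])
      qed
      then show ?thesis
        using max[OF frac_vec_in_cbox True] by simp
    next
      case False
      have "r \<le> r * r"
        using r by simp
      also have "r * r \<le> norm z * norm z"
        using False r by (intro mult_mono) auto
      also have "\<dots> = z \<bullet> z"
        by (simp add: dot_square_norm power2_eq_square)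
      finally have "k * r \<le> k * (z \<bullet> z)"
        using k by simp
      moreover have "k * r = 2 * (M1 + M2) + k"
        using k by (simp add: r_def distrib_left[of k _ 1])
      ultimately have "F (x, z) \<le> - (M1 + M2)"
        using M1(2)[of x] M2(2)[of "x + z"] k by (simp add: F_def abs_le_iff)
      also have "\<dots> \<le> F (0, 0)"
        using M1(2)[of 0] M2(2)[of 0] by (simp add: F_def abs_le_iff)
      also have "\<dots> \<le> F (x1, z1)"
        using r by (intro max) (auto simp: mem_box_cart)
      finally show ?thesis .
    qed
    define y1 where "y1 = x1 + z1"
    have sym: "(x - y) \<bullet> (x - y) = (y - x) \<bullet> (y - x)" for x y :: "real^'n"
      by (simp add: inner_diff_left inner_diff_right inner_commute)
    have dbl: "u x - v y - k * ((x - y) \<bullet> (x - y)) \<le> u x1 - v y1 - k * ((x1 - y1) \<bullet> (x1 - y1))" for x y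
      using glob[of x "y - x"] sym[of x y] by (simp add: F_def y1_def)
    define p where "p = (2 * k) *\<^sub>R (x1 - y1)"
    have "H x1 ((2 * k) *\<^sub>R (x1 - y1)) \<le> a"
    proof (rule u(1)[unfolded viscosity_subsolution_def, rule_format, OF conjI])
      show "C1_with_gradient (\<lambda>x. k * ((x - y1) \<bullet> (x - y1))) (\<lambda>x. (2 * k) *\<^sub>R (x - y1))"
        by (rule C1_with_gradient_quadratic)
      show "\<forall>\<^sub>F x in nhds x1. u x - k * ((x - y1) \<bullet> (x - y1)) \<le> u x1 - k * ((x1 - y1) \<bullet> (x1 - y1))"
        using dbl[of _ y1] by (intro always_eventually allI) (simp add: algebra_simps)
    qed
    then have 1: "H x1 p \<le> a"
      by (simp add: p_def)
    \<comment> \<open>The test function for \<open>v\<close> carries the opposite sign and the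
      points are swapped, so both tests see the same covector \<open>p\<close>.\<close>
    have "b \<le> H y1 ((2 * - k) *\<^sub>R (y1 - x1))"
    proof (rule v(1)[unfolded viscosity_supersolution_def, rule_format, OF conjI])
      show "C1_with_gradient (\<lambda>x. - k * ((x - x1) \<bullet> (x - x1))) (\<lambda>x. (2 * - k) *\<^sub>R (x - x1))"
        by (rule C1_with_gradient_quadratic)
      have "v y1 + k * ((y1 - x1) \<bullet> (y1 - x1)) \<le> v y + k * ((y - x1) \<bullet> (y - x1))" for y
        using dbl[of x1 y] sym[of x1 y] sym[of x1 y1] by simp
      then show "\<forall>\<^sub>F y in nhds y1. v y1 - - k * ((y1 - x1) \<bullet> (y1 - x1)) \<le> v y - - k * ((y - x1) \<bullet> (y - x1))"
        by (intro always_eventually allI) simp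
    qed
    also have "(2 * - k) *\<^sub>R (y1 - x1) = p"
      by (simp add: p_def flip: scaleR_minus_right)
    finally have 2: "b \<le> H y1 p" .
    have P: "norm p \<le> \<bar>P\<bar>"
      using C0[of p x1] 1 by (simp add: P_def)
    have "norm (y1 - x1) = e * norm p"
      using e by (simp add: p_def k_def norm_minus_commute)
    also have "\<dots> \<le> e * \<bar>P\<bar>"
      using P e by simp
    finally have "C * norm (y1 - x1) \<le> C * (e * \<bar>P\<bar>)"
      using C(1) by (rule mult_left_mono)
    then show ?thesis
      using 1 2 C(2)[OF P, of y1 x1] by (simp add: algebra_simps)
  qed
  then show ?thesis
    using C(1) by - (rule le_of_forall_le_add_mult[of "C * \<bar>P\<bar>"], simp_all)
qed

lemma critical_value_eqI:
  fixes H :: "real^'n \<Rightarrow> real^'n \<Rightarrow> real"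
  assumes "superlinear H"
    and lip: "\<And>P. \<exists>C\<ge>0. \<forall>x y p. norm p \<le> P \<longrightarrow> \<bar>H x p - H y p\<bar> \<le> C * norm (x - y)"
    and "viscosity_solution H c u"
  shows "critical_value H = c"
  unfolding critical_value_def
proof (rule the_equality)
  show "\<exists>u. viscosity_solution H c u"
    using assms(3) by blast
  fix c' assume "\<exists>u. viscosity_solution H c' u"
  then obtain u' where "viscosity_solution H c' u'" ..
  then show "c' = c"
    using assms(3) viscosity_comparison[OF assms(1) lip, of c u c' u']
      viscosity_comparison[OF assms(1) lip, of c' u' c u]
    by (simp add: viscosity_solution_def)
qed

subsection \<open>From the Hamiltonian to the Lagrangian\<close>

locale tonelli =
  fixes H :: "real^'n \<Rightarrow> real^'n \<Rightarrow> real"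
  assumes tonelli: "tonelli_hamiltonian H"
begin

lemma H_periodic: "periodic H"
  and H_superlinear: "superlinear H"
  and H_pos_definite: "pos_definite (hessian (H x) p)"
  using tonelli by (auto simp: tonelli_hamiltonian_def)

lemma H_C2: "C2_function (\<lambda>(x, p). H x p)"
  using tonelli by (simp add: tonelli_hamiltonian_def)

lemma H_lower_bound:
  assumes "K > 0"
  obtains C where "\<And>x p. K * norm p - C \<le> H x p"
  using H_superlinear assms unfolding superlinear_def by blast

lemma H_bounded:
  obtains M where "M \<ge> 0" "\<And>x p. norm p \<le> P \<Longrightarrow> \<bar>H x p\<bar> \<le> M"
proof -
  obtain f' where f': "\<And>z. ((\<lambda>(x, p). H x p) has_derivative blinfun_apply (f' z)) (at z)"
    using H_C2 unfolding C2_function_def by blast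
  have "continuous_on (cbox 0 1 \<times> cball 0 P) (\<lambda>(x, p). H x p)"
    by (intro continuous_at_imp_continuous_on ballI has_derivative_continuous[OF f'])
  then have "compact ((\<lambda>(x, p). H x p) ` (cbox 0 1 \<times> cball 0 P))"
    by (rule compact_continuous_image) (intro compact_Times compact_cbox compact_cball)
  then have "bounded ((\<lambda>(x, p). H x p) ` (cbox 0 1 \<times> cball 0 P))"
    by (rule compact_imp_bounded)
  then obtain M where "\<forall>x\<in>cbox 0 1. \<forall>p\<in>cball 0 P. \<bar>H x p\<bar> \<le> M"
    by (auto simp: bounded_iff)
  then have M: "\<bar>H x p\<bar> \<le> M" if "x \<in> cbox 0 1" "norm p \<le> P" for x p
    using that by simp
  have "\<bar>H x p\<bar> \<le> max M 0" if "norm p \<le> P" for x p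
    using M[OF frac_vec_in_cbox[of x] that] periodic_frac_vec[OF H_periodic, of x] by simp
  then show ?thesis
    using that[of "max M 0"] by simp
qed

text \<open>After a common integer shift, points at distance at most 1 lie in one convex compact
  set, where the derivative is bounded. No common shift does this for distant points; for them the
  uniform bound on \<open>H\<close> suffices.\<close>

lemma H_lipschitz: "\<exists>C\<ge>0. \<forall>x y p. norm p \<le> P \<longrightarrow> \<bar>H x p - H y p\<bar> \<le> C * norm (x - y)"
proof -
  obtain f' :: "(real^'n) \<times> (real^'n) \<Rightarrow> ((real^'n) \<times> (real^'n)) \<Rightarrow>\<^sub>L real" and f''
    where f': "\<And>z. ((\<lambda>(x, p). H x p) has_derivative blinfun_apply (f' z)) (at z)"
      and f'': "\<And>z. (f' has_derivative blinfun_apply (f'' z)) (at z)"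
    using H_C2 unfolding C2_function_def by blast
  have "bounded (cbox 0 1 :: (real^'n) set)"
    by (rule bounded_cbox)
  then obtain r where r: "\<And>x::real^'n. x \<in> cbox 0 1 \<Longrightarrow> norm x \<le> r"
    by (auto simp: bounded_iff)
  define S where "S = cball (0::real^'n) (r + 1) \<times> cball (0::real^'n) P"
  have "continuous_on S f'"
    by (intro continuous_at_imp_continuous_on ballI has_derivative_continuous[OF f''])
  then have "compact (f' ` S)"
    unfolding S_def by (rule compact_continuous_image) (intro compact_Times compact_cball)
  then have "bounded (f' ` S)"
    by (rule compact_imp_bounded)
  then obtain B where B: "\<And>z. z \<in> S \<Longrightarrow> norm (f' z) \<le> B"
    by (auto simp: bounded_iff)
  obtain M where M: "M \<ge> 0" "\<And>x p. norm p \<le> P \<Longrightarrow> \<bar>H x p\<bar> \<le> M"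
    using H_bounded by blast
  define C where "C = \<bar>B\<bar> + 2 * M"
  have "\<bar>H x p - H y p\<bar> \<le> C * norm (x - y)" if p: "norm p \<le> P" for x y p
  proof (cases "norm (x - y) \<le> 1")
    case True
    define l where "l = x - frac_vec x"
    have l: "l \<in> int_lattice"
      unfolding l_def by (rule frac_vec_diff)
    have "norm (x - l) \<le> r"
      using r[OF frac_vec_in_cbox[of x]] by (simp add: l_def)
    moreover have "norm (y - l) \<le> norm (x - l) + norm (x - y)"
      using norm_triangle_ineq4[of "x - l" "x - y"] by simp
    ultimately have S: "(x - l, p) \<in> S" "(y - l, p) \<in> S"
      using True p by (auto simp: S_def)
    have "norm ((\<lambda>(x, p). H x p) (x - l, p) - (\<lambda>(x, p). H x p) (y - l, p))
        \<le> B * norm ((x - l, p) - (y - l, p))"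
    proof (rule differentiable_bound[OF _ _ _ S])
      show "convex S"
        unfolding S_def by (intro convex_Times convex_cball)
      show "((\<lambda>(x, p). H x p) has_derivative blinfun_apply (f' z)) (at z within S)" for z
        by (rule has_derivative_at_withinI[OF f'])
      show "onorm (blinfun_apply (f' z)) \<le> B" if "z \<in> S" for z
        using B[OF that] by (simp add: norm_blinfun.rep_eq)
    qed
    then have "\<bar>H x p - H y p\<bar> \<le> B * norm (x - y)"
      by (simp add: periodicD_minus[OF H_periodic l] norm_prod_def)
    also have "\<dots> \<le> C * norm (x - y)"
      using M(1) by (intro mult_right_mono) (auto simp: C_def)
    finally show ?thesis .
  next
    case False
    have "\<bar>H x p - H y p\<bar> \<le> 2 * M"
      using M(2)[OF p, of x] M(2)[OF p, of y] by linarith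
    also have "\<dots> \<le> 2 * M * norm (x - y)"
      using False M(1) by (simp add: mult_le_cancel_left1)
    also have "\<dots> \<le> C * norm (x - y)"
      by (intro mult_right_mono) (auto simp: C_def)
    finally show ?thesis .
  qed
  moreover have "C \<ge> 0"
    using M(1) by (simp add: C_def)
  ultimately show ?thesis by blast
qed

text \<open>A positive definite Hessian makes \<open>H x\<close> convex along every line, so the
  tangent at \<open>p\<close> stays below the graph; \<open>v\<close> is the gradient at
  \<open>p\<close>.\<close>

lemma H_subgradient:
  obtains v where "\<And>q. H x p + (q - p) \<bullet> v \<le> H x q"
proof -
  obtain f' :: "(real^'n) \<times> (real^'n) \<Rightarrow> ((real^'n) \<times> (real^'n)) \<Rightarrow>\<^sub>L real" and f''
    where f': "\<And>z. ((\<lambda>(x, p). H x p) has_derivative blinfun_apply (f' z)) (at z)"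
      and f'': "\<And>z. (f' has_derivative blinfun_apply (f'' z)) (at z)"
    using H_C2 unfolding C2_function_def by blast
  have D1: "(H x has_derivative (\<lambda>h. f' (x, q) (0, h))) (at q)" for q
  proof -
    have "((\<lambda>q. (x, q)) has_derivative (\<lambda>h. (0, h))) (at q)"
      by (auto intro!: derivative_eq_intros)
    from has_derivative_compose[OF this f'] show ?thesis
      by simp
  qed
  have D2: "((\<lambda>q. f' (x, q) w) has_derivative (\<lambda>h. f'' (x, q) (0, h) w)) (at q)" for q w
  proof -
    have "((\<lambda>q. (x, q)) has_derivative (\<lambda>h. (0, h))) (at q)"
      by (auto intro!: derivative_eq_intros)
    from has_derivative_compose[OF this f''] 
    have "((\<lambda>q. f' (x, q)) has_derivative (\<lambda>h. f'' (x, q) (0, h))) (at q)" .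
    from bounded_linear.has_derivative[OF blinfun.bounded_linear_left this]
    show ?thesis .
  qed
  have hess: "hessian (H x) q $ i $ j = f'' (x, q) (0, axis i 1) (0, axis j 1)" for q i j
  proof -
    have "frechet_derivative (H x) (at q) = (\<lambda>h. f' (x, q) (0, h))" for q
      by (rule frechet_derivative_at[OF D1, symmetric])
    then have "hessian (H x) q $ i $ j
        = frechet_derivative (\<lambda>q. f' (x, q) (0, axis j 1)) (at q) (axis i 1)"
      by (simp add: hessian_def)
    also have "\<dots> = f'' (x, q) (0, axis i 1) (0, axis j 1)"
      by (simp only: frechet_derivative_at[OF D2, symmetric])
    finally show ?thesis .
  qed
  have nonneg: "f'' (x, q) (0, \<xi>) (0, \<xi>) \<ge> 0" for q \<xi>
  proof (cases "\<xi> = 0")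
    case True
    then show ?thesis by (simp flip: zero_prod_def)
  next
    case False
    \<comment> \<open>Expansion along the axes identifies the second derivative in the momentum
      directions with the quadratic form of \<open>hessian\<close>.\<close>
    have expand: "((0, \<xi>) :: (real^'n) \<times> (real^'n)) = (\<Sum>i\<in>UNIV. (\<xi> $ i) *\<^sub>R (0, axis i 1))"
    proof -
      have "(\<Sum>i\<in>UNIV. (\<xi> $ i) *\<^sub>R ((0, axis i 1) :: (real^'n) \<times> (real^'n)))
          = (0, \<Sum>i\<in>UNIV. (\<xi> $ i) *\<^sub>R axis i 1)"
        by (simp add: prod_eq_iff fst_sum snd_sum)
      also have "(\<Sum>i\<in>UNIV. (\<xi> $ i) *\<^sub>R axis i 1) = \<xi>"
        using basis_expansion[of \<xi>] by (simp add: scalar_mult_eq_scaleR)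
      finally show ?thesis by simp
    qed
    have "f'' (x, q) (0, \<xi>) (0, \<xi>)
        = (\<Sum>j\<in>UNIV. \<Sum>i\<in>UNIV. \<xi> $ j * (\<xi> $ i * f'' (x, q) (0, axis i 1) (0, axis j 1)))"
      unfolding expand
      by (simp add: blinfun.sum_right blinfun.sum_left blinfun.scaleR_right blinfun.scaleR_left
          sum_distrib_left mult_ac del: scaleR_Pair)
    also have "\<dots> = (\<Sum>i\<in>UNIV. \<Sum>j\<in>UNIV. \<xi> $ j * (\<xi> $ i * f'' (x, q) (0, axis i 1) (0, axis j 1)))"
      by (rule sum.swap)
    also have "\<dots> = \<xi> \<bullet> (hessian (H x) q *v \<xi>)"
      by (simp add: inner_vec_def matrix_vector_mult_def hess sum_distrib_left mult_ac)
    finally show ?thesis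
      using H_pos_definite[of x q] False by (simp add: pos_definite_def less_imp_le)
  qed
  \<comment> \<open>The adjoint evaluated at 1 is the vector representing the derivative, that is,
    the gradient.\<close>
  have "linear (\<lambda>h. f' (x, p) (0, h))"
    by (rule has_derivative_linear[OF D1])
  then have "f' (x, p) (0, h) = h \<bullet> adjoint (\<lambda>h. f' (x, p) (0, h)) 1" for h
    using adjoint_works[of "\<lambda>h. f' (x, p) (0, h)" h 1] by simp
  then obtain v where v: "\<And>h. f' (x, p) (0, h) = h \<bullet> v"
    by blast
  have "H x p + f' (x, p) (0, q - p) \<le> H x q" for q
  proof -
    define w where "w = q - p"
    define g where "g t = H x (p + t *\<^sub>R w)" for t
    have line: "((\<lambda>t. p + t *\<^sub>R w) has_derivative (\<lambda>h. h *\<^sub>R w)) (at t)" for t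
      by (auto intro!: derivative_eq_intros)
    have scale: "((0, h *\<^sub>R w) :: (real^'n) \<times> (real^'n)) = h *\<^sub>R (0, w)" for h
      by simp
    have g1: "(g has_real_derivative f' (x, p + t *\<^sub>R w) (0, w)) (at t)" for t
      unfolding g_def[abs_def] has_field_derivative_def
      by (rule has_derivative_eq_rhs[OF has_derivative_compose[OF line D1]])
        (simp add: scale blinfun.scaleR_right fun_eq_iff del: scaleR_Pair)
    have g2: "((\<lambda>t. f' (x, p + t *\<^sub>R w) (0, w)) has_real_derivative
        f'' (x, p + t *\<^sub>R w) (0, w) (0, w)) (at t)" for t
      unfolding has_field_derivative_def
      by (rule has_derivative_eq_rhs[OF has_derivative_compose[OF line D2]])
        (simp add: scale blinfun.scaleR_right blinfun.scaleR_left fun_eq_iff del: scaleR_Pair)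
    have "convex_on UNIV g"
      by (rule f''_ge0_imp_convex[OF convex_UNIV]) (use g1 g2 nonneg in auto)
    from convex_on_imp_above_tangent[OF this connected_UNIV _ _ g1[of 0], of 1]
    have "f' (x, p) (0, w) \<le> g 1 - g 0"
      by simp
    then show ?thesis
      by (simp add: g_def w_def)
  qed
  then show ?thesis
    by (intro that[of v]) (simp add: v)
qed

section \<open>Legendre transform and its estimates\<close>

lemma bdd_above_lagrangian: "bdd_above (range (\<lambda>p. p \<bullet> v - H x p))"
proof -
  have "norm v + 1 > 0"
    using norm_ge_zero[of v] by linarith
  then obtain C where C: "\<And>x p. (norm v + 1) * norm p - C \<le> H x p"
    using H_lower_bound by blast
  have "p \<bullet> v - H x p \<le> C" for p
  proof -
    have "p \<bullet> v \<le> norm v * norm p"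
      using norm_cauchy_schwarz[of p v] by (simp add: mult.commute)
    then show ?thesis
      using C[of p x] norm_ge_zero[of p] unfolding distrib_right by linarith
  qed
  then show ?thesis
    by (rule bdd_aboveI2)
qed

lemma lagrangian_ge: "p \<bullet> v - H x p \<le> lagrangian H x v"
  unfolding lagrangian_def by (rule cSUP_upper[OF UNIV_I bdd_above_lagrangian])

lemma lagrangian_leI: "(\<And>p. p \<bullet> v - H x p \<le> m) \<Longrightarrow> lagrangian H x v \<le> m"
  unfolding lagrangian_def by (rule cSUP_least) auto

text \<open>Test the supremum with the momentum of length \<open>\<bar>K\<bar>\<close> in the
  direction of \<open>v\<close>, and use that \<open>H\<close> is bounded on such momenta.\<close>

lemma lagrangian_superlinear: "\<exists>C. \<forall>x v. K * norm v - C \<le> lagrangian H x v"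
proof -
  obtain M where M: "\<And>x p. norm p \<le> \<bar>K\<bar> \<Longrightarrow> \<bar>H x p\<bar> \<le> M"
    using H_bounded by blast
  have "K * norm v - M \<le> lagrangian H x v" for x v
  proof -
    have "(\<bar>K\<bar> *\<^sub>R sgn v) \<bullet> v = \<bar>K\<bar> * norm v"
      by (cases "v = 0") (simp_all add: sgn_div_norm dot_square_norm power2_eq_square)
    moreover have "norm (\<bar>K\<bar> *\<^sub>R sgn v) \<le> \<bar>K\<bar>"
      by (simp add: norm_sgn)
    moreover have "K * norm v \<le> \<bar>K\<bar> * norm v"
      by (intro mult_right_mono) auto
    ultimately show ?thesis
      using lagrangian_ge[of "\<bar>K\<bar> *\<^sub>R sgn v" v x] M[of "\<bar>K\<bar> *\<^sub>R sgn v" x] by linarith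
  qed
  then show ?thesis by blast
qed

text \<open>Growth of \<open>H\<close> with slope \<open>\<bar>R\<bar> + 1\<close> leaves the
  surplus \<open>- norm p\<close>, which confines the relevant momenta to a ball.\<close>

lemma lagrangian_slope_bound:
  obtains C where "\<And>x v p. norm v \<le> R \<Longrightarrow> p \<bullet> v - H x p \<le> C - norm p"
proof -
  have "\<bar>R\<bar> + 1 > 0"
    by linarith
  then obtain C where C: "\<And>x p. (\<bar>R\<bar> + 1) * norm p - C \<le> H x p"
    using H_lower_bound by blast
  have "p \<bullet> v - H x p \<le> C - norm p" if "norm v \<le> R" for x v p
  proof -
    have "p \<bullet> v \<le> norm p * \<bar>R\<bar>"
    proof -
      have "norm p * norm v \<le> norm p * \<bar>R\<bar>"
        using that by (intro mult_left_mono) auto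
      then show ?thesis
        using norm_cauchy_schwarz[of p v] by linarith
    qed
    then show ?thesis
      using C[of p x] by (simp add: algebra_simps)
  qed
  then show ?thesis using that by blast
qed

lemma lagrangian_bounded: "\<exists>C. \<forall>x v. norm v \<le> R \<longrightarrow> lagrangian H x v \<le> C"
proof -
  obtain C where C: "\<And>x v p. norm v \<le> R \<Longrightarrow> p \<bullet> v - H x p \<le> C - norm p"
    using lagrangian_slope_bound by blast
  have "lagrangian H x v \<le> C" if "norm v \<le> R" for x v
  proof (rule lagrangian_leI)
    fix p show "p \<bullet> v - H x p \<le> C"
      using C[OF that, of p x] norm_ge_zero[of p] by linarith
  qed
  then show ?thesis by blast
qed

lemma lagrangian_lipschitz:
  "\<exists>C\<ge>0. \<forall>x y v w. norm v \<le> R \<longrightarrow> norm w \<le> R \<longrightarrow>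
    \<bar>lagrangian H x v - lagrangian H y w\<bar> \<le> C * (norm (x - y) + norm (v - w))"
proof -
  obtain A where A: "\<And>x v p. norm v \<le> R \<Longrightarrow> p \<bullet> v - H x p \<le> A - norm p"
    using lagrangian_slope_bound by blast
  obtain M where M: "M \<ge> 0" "\<And>x p. norm p \<le> 0 \<Longrightarrow> \<bar>H x p\<bar> \<le> M"
    using H_bounded[of 0] by blast
  \<comment> \<open>Momenta outside this radius lose against \<open>p = 0\<close>: there
    \<open>A - norm p < - M \<le> - H y 0 \<le> lagrangian H y w\<close>. Inside, both arguments
    enter with bounded slope.\<close>
  define P where "P = \<bar>A\<bar> + M"
  obtain B where B: "B \<ge> 0" "\<And>x y p. norm p \<le> P \<Longrightarrow> \<bar>H x p - H y p\<bar> \<le> B * norm (x - y)"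
    using H_lipschitz[of P] by blast
  have P: "P \<ge> 0"
    using M(1) by (simp add: P_def)
  have le: "lagrangian H x v \<le> lagrangian H y w + (P + B) * (norm (x - y) + norm (v - w))"
    if v: "norm v \<le> R" for x y v w
  proof (rule lagrangian_leI)
    fix p
    have "P * norm (v - w) + B * norm (x - y) \<le> (P + B) * (norm (x - y) + norm (v - w))"
      using P B(1) by (simp add: algebra_simps)
    moreover have "p \<bullet> v - H x p \<le> lagrangian H y w + (P * norm (v - w) + B * norm (x - y))"
    proof (cases "norm p \<le> P")
      case True
      have "p \<bullet> v - p \<bullet> w \<le> P * norm (v - w)"
        using norm_cauchy_schwarz[of p "v - w"] mult_right_mono[OF True, of "norm (v - w)"]
        by (simp add: inner_diff_right)
      then show ?thesis
        using lagrangian_ge[of p w y] B(2)[OF True, of x y] by linarith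
    next
      case False
      have "0 \<le> P * norm (v - w) + B * norm (x - y)"
        using P B(1) by simp
      then show ?thesis
        using A[OF v, of p x] False lagrangian_ge[of 0 w y] M(2)[of 0 y] by (simp add: P_def)
    qed
    ultimately show "p \<bullet> v - H x p \<le> lagrangian H y w + (P + B) * (norm (x - y) + norm (v - w))"
      by linarith
  qed
  have "\<bar>lagrangian H x v - lagrangian H y w\<bar> \<le> (P + B) * (norm (x - y) + norm (v - w))"
    if "norm v \<le> R" "norm w \<le> R" for x y v w
    using le[OF that(1), of x y w] le[OF that(2), of y x v] by (simp add: abs_le_iff norm_minus_commute)
  moreover have "P + B \<ge> 0"
    using P B(1) by simp
  ultimately show ?thesis by blast
qed

lemma lagrangian_convex: "convex_on UNIV (lagrangian H x)"
proof (rule convex_onI)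
  fix t :: real and v w assume t: "0 < t" "t < 1"
  show "lagrangian H x ((1 - t) *\<^sub>R v + t *\<^sub>R w) \<le> (1 - t) * lagrangian H x v + t * lagrangian H x w"
  proof (rule lagrangian_leI)
    fix p
    have "p \<bullet> ((1 - t) *\<^sub>R v + t *\<^sub>R w) - H x p = (1 - t) * (p \<bullet> v - H x p) + t * (p \<bullet> w - H x p)"
      by (simp add: inner_add_right algebra_simps)
    also have "\<dots> \<le> (1 - t) * lagrangian H x v + t * lagrangian H x w"
      using t by (intro add_mono mult_left_mono lagrangian_ge) auto
    finally show "p \<bullet> ((1 - t) *\<^sub>R v + t *\<^sub>R w) - H x p \<le> \<dots>" .
  qed
qed simp

text \<open>A subgradient of \<open>H x\<close> at \<open>p\<close> gives equality in the Fenchel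
  inequality; this recovers \<open>H\<close> from its Lagrangian.\<close>

lemma lagrangian_attained: "\<exists>v. lagrangian H x v \<le> p \<bullet> v - H x p"
proof -
  obtain v where v: "\<And>q. H x p + (q - p) \<bullet> v \<le> H x q"
    using H_subgradient by blast
  have "lagrangian H x v \<le> p \<bullet> v - H x p"
  proof (rule lagrangian_leI)
    fix q show "q \<bullet> v - H x q \<le> p \<bullet> v - H x p"
      using v[of q] by (simp add: inner_diff_left)
  qed
  then show ?thesis ..
qed

sublocale tonelli_pair "lagrangian H" H
proof unfold_locales
  show "periodic (lagrangian H)"
    using H_periodic by (auto simp: periodic_def lagrangian_def fun_eq_iff)
qed (rule lagrangian_convex lagrangian_superlinear lagrangian_bounded lagrangian_lipschitz
    lagrangian_ge lagrangian_attained)+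

end

theorem theorem3p3:
  fixes H :: "real^'n \<Rightarrow> real^'n \<Rightarrow> real"
  assumes "tonelli_hamiltonian H"
  shows "\<exists>\<tau>\<^sub>0>0. \<exists>\<eta>\<^sub>0>0. \<exists>C>0. \<forall>(N::nat) (h::real) (\<tau>::real).
    N \<ge> 1 \<longrightarrow> h = 1 / real N \<longrightarrow> 0 < \<tau> \<longrightarrow> \<tau> \<le> \<tau>\<^sub>0 \<longrightarrow> h / \<tau> \<le> \<eta>\<^sub>0 \<longrightarrow>
    \<bar>discrete_critical_value (lagrangian H) N \<tau> + critical_value H\<bar> \<le> C * (\<tau> + h / \<tau>)"
proof -
  interpret tonelli H
    by unfold_locales (rule assms)
  obtain c u where cu: "weak_kam c u"
    using weak_kam_exists .
  have crit: "critical_value H = - c"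
    by (rule critical_value_eqI[OF H_superlinear H_lipschitz weak_kam_viscosity_solution[OF cu]])
  obtain C where C: "C > 0" "\<And>N \<tau>. N \<ge> 1 \<Longrightarrow> \<tau> > 0 \<Longrightarrow> 1 / real N \<le> \<tau> \<Longrightarrow>
      \<bar>discrete_critical_value (lagrangian H) N \<tau> - c\<bar> \<le> C * (\<tau> + 1 / real N / \<tau>)"
    using discrete_critical_value_near_weak_kam[OF cu] by blast
  have "\<bar>discrete_critical_value (lagrangian H) N \<tau> + critical_value H\<bar> \<le> C * (\<tau> + h / \<tau>)"
    if "N \<ge> 1" "h = 1 / real N" "0 < \<tau>" "h / \<tau> \<le> 1" for N h \<tau>
  proof -
    \<comment> \<open>The choice \<open>1\<close> for the bound on \<open>h / \<tau>\<close> is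
      exactly \<open>h \<le> \<tau>\<close>, the regime of the uniform estimates.\<close>
    have "1 / real N \<le> \<tau>"
      using that by (simp add: pos_divide_le_eq mult.commute)
    then show ?thesis
      using C(2)[of N \<tau>] that(1-3) by (simp add: crit)
  qed
  then have "\<forall>N h \<tau>. N \<ge> 1 \<longrightarrow> h = 1 / real N \<longrightarrow> 0 < \<tau> \<longrightarrow> \<tau> \<le> 1 \<longrightarrow> h / \<tau> \<le> 1 \<longrightarrow>
      \<bar>discrete_critical_value (lagrangian H) N \<tau> + critical_value H\<bar> \<le> C * (\<tau> + h / \<tau>)"
    by blast
  then show ?thesis
    using C(1) zero_less_one by blast
qed

end
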